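(* Assume the setting and standing assumption described in the context. Suppose that for all $t\ge t_0$ $$1+\theta-\theta t\alpha(t)\le 0,\qquad (2\theta-1)\beta(t)+\theta t\dot\beta(t)\le 0,\qquad \alpha(t)+t\dot\alpha(t)\le t\beta(t)\epsilon(t).$$ Assume further that $\lim_{t\to+\infty}t^2\beta(t)=+\infty$ and $\int_{t_0}^{+\infty}t\beta(t)\epsilon(t)\,\mathrm{d}t<+\infty$. Then, for any trajectory $(x(t),y(t))$ of the system (GTRD) and any saddle point $(x^*,y^* )\in\Omega$, the trajectory $(x(t),y(t))$ is bounded on $[t_0,+\infty)$, and, as $t\to+\infty$, $$\mathcal{L}(x(t),y^* )-\mathcal{L}(x^*,y(t))=\mathcal{O}\left(\frac{1}{t^2\beta(t)}\right),$$ $$\|\dot x(t)\|=\mathcal{O}\left(\frac1t\right),\qquad \|\dot y(t)\|=\mathcal{O}\left(\frac1t\right),$$ $$\|\nabla f(x(t))-\nabla f(x^* )\|=\mathcal{O}\left(\frac{1}{t\sqrt{\beta(t)}}\right),\qquad \|\nabla g(y(t))-\nabla g(y^* )\|=\mathcal{O}\left(\frac{1}{t\sqrt{\beta(t)}}\right).$$ In particular, if $1+\theta-\theta t\alpha(t)<0$ for all $t\ge t_0$, then $$\int_{t_0}^{+\infty}t\left(t\alpha(t)-\frac1\theta-1\right)\left(\|\dot x(t)\|^2+\|\dot y(t)\|^2\right)\mathrm{d}t<+\infty.$$ Furthermore, if $(2\theta-1)\beta(t)+\theta t\dot\beta(t)<0$ for all $t\ge t_0$, then $$\int_{t_0}^{+\infty}\left((1-2\theta)\beta(t)-\theta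 t\dot\beta(t)\right)t\left(\mathcal{L}(x(t),y^* )-\mathcal{L}(x^*,y(t))\right)\mathrm{d}t<+\infty,$$ $$\int_{t_0}^{+\infty}\left((1-2\theta)\beta(t)-\theta t\dot\beta(t)\right)t\,\|\nabla f(x(t))-\nabla f(x^* )\|^2\,\mathrm{d}t<+\infty,$$ $$\int_{t_0}^{+\infty}\left((1-2\theta)\beta(t)-\theta t\dot\beta(t)\right)t\,\|\nabla g(y(t))-\nabla g(y^* )\|^2\,\mathrm{d}t<+\infty.$$
   Context: Standing assumption: $f:\mathbb{R}^n\to\mathbb{R}$ and $g:\mathbb{R}^m\to\mathbb{R}$ are continuously differentiable convex functions whose gradients $\nabla f$, $\nabla g$ are $L_1$- and $L_2$-Lipschitz continuous, respectively, with $L_1,L_2>0$; $K\in\mathbb{R}^{m\times n}$ with adjoint $K^*$; $t_0>0$ and $\theta>0$ are constants; $\alpha,\beta,\epsilon:[t_0,+\infty)\to(0,+\infty)$ are of class $\mathcal{C}^1$, and $\epsilon$ is nonincreasing with $\lim_{t\to+\infty}\epsilon(t)=0$. Norms and inner products are Euclidean. Lagrangian: $\mathcal{L}(x,y)=f(x)+\langle Kx,y\rangle-g(y)$ on $\mathbb{R}^n\times\mathbb{R}^m$. A pair $(x^*,y^* )$ is a saddle point of $\mathcal{L}$ if $\mathcal{L}(x^*,y)\le\mathcal{L}(x^*,y^* )\le\mathcal{L}(x,y^* )$ for all $(x,y)\in\mathbb{R}^n\times\mathbb{R}^m$; $\Omega$ is the set of saddle points. Regularized function: $\mathcal{L}_t(x,y)=\mathcal{L}(x,y)+\frac{\epsilon(t)}{2}(\|x\|^2-\|y\|^2)$.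 System (GTRD), for $t\ge t_0$: $$\ddot x(t)+\alpha(t)\dot x(t)+\beta(t)\nabla_x\mathcal{L}_t\big(x(t),y(t)+\theta t\dot y(t)\big)=0,$$ $$\ddot y(t)+\alpha(t)\dot y(t)-\beta(t)\nabla_y\mathcal{L}_t\big(x(t)+\theta t\dot x(t),y(t)\big)=0,$$ where $\nabla_x\mathcal{L}_t(x,y)=\nabla f(x)+K^*y+\epsilon(t)x$ and $\nabla_y\mathcal{L}_t(x,y)=-\nabla g(y)+Kx-\epsilon(t)y$. A trajectory is a global strong solution: $x\in W^{2,1}_{\mathrm{loc}}([t_0,+\infty);\mathbb{R}^n)$, $y\in W^{2,1}_{\mathrm{loc}}([t_0,+\infty);\mathbb{R}^m)$, satisfying the system for almost every $t>t_0$. *)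

theory Defs
  imports "HOL-Analysis.Analysis" "HOL-Library.Landau_Symbols"
begin

definition gradient :: "('a::real_inner \<Rightarrow> real) \<Rightarrow> 'a \<Rightarrow> 'a" where
  "gradient f x = (THE D. GDERIV f x :> D)"

lemma gradient_eqI:
  assumes "GDERIV f x :> D"
  shows "gradient f x = D"
  unfolding gradient_def
proof (rule the_equality)
  fix D' assume "GDERIV f x :> D'"
  then have "(\<lambda>h. h \<bullet> D') = (\<lambda>h. h \<bullet> D)"
    using assms unfolding gderiv_def by (rule has_derivative_unique)
  then have "h \<bullet> D' = h \<bullet> D" for h by metis
  then show "D' = D" using vector_eq_ldot by blast
qed (rule assms)

lemma GDERIV_gradient:
  fixes f :: "'a::euclidean_space \<Rightarrow> real"
  assumes "f differentiable (at x)"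
  shows "GDERIV f x :> gradient f x"
proof -
  obtain f' where f': "(f has_derivative f') (at x)"
    using assms by (auto simp: differentiable_def)
  then have "linear f'" by (rule has_derivative_linear)
  then have "f' = (\<lambda>h. h \<bullet> adjoint f' 1)"
    using adjoint_works[of f' _ 1] by (auto simp: fun_eq_iff)
  with f' have "GDERIV f x :> adjoint f' 1" by (metis gderiv_def)
  then show ?thesis using gradient_eqI by metis
qed

text \<open>Convex, continuously differentiable, with \<open>L\<close>-Lipschitz gradient.\<close>

definition convex_C1_lipschitz_gradient :: "real \<Rightarrow> ('a::euclidean_space \<Rightarrow> real) \<Rightarrow> bool" where
  "convex_C1_lipschitz_gradient L f \<longleftrightarrow>
     convex_on UNIV f \<and>
     (\<forall>x. f differentiable (at x)) \<and> continuous_on UNIV (gradient f) \<and>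
     L-lipschitz_on UNIV (gradient f)"

definition lagrangian ::
  "(real^'n \<Rightarrow> real) \<Rightarrow> (real^'m \<Rightarrow> real) \<Rightarrow> real^'n^'m \<Rightarrow> real^'n \<Rightarrow> real^'m \<Rightarrow> real" where
  "lagrangian f g K x y = f x + (K *v x) \<bullet> y - g y"

definition saddle_points ::
  "(real^'n \<Rightarrow> real) \<Rightarrow> (real^'m \<Rightarrow> real) \<Rightarrow> real^'n^'m \<Rightarrow> ((real^'n) \<times> (real^'m)) set" where
  "saddle_points f g K = {(xs, ys). \<forall>x y.
     lagrangian f g K xs y \<le> lagrangian f g K xs ys \<and>
     lagrangian f g K xs ys \<le> lagrangian f g K x ys}"

text \<open>The parameter \<open>e\<close> stands for the value \<open>\<epsilon>(t)\<close> at a fixed time.\<close>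

definition reg_lagrangian ::
  "(real^'n \<Rightarrow> real) \<Rightarrow> (real^'m \<Rightarrow> real) \<Rightarrow> real^'n^'m \<Rightarrow> real
    \<Rightarrow> real^'n \<Rightarrow> real^'m \<Rightarrow> real" where
  "reg_lagrangian f g K e x y =
     lagrangian f g K x y + e / 2 * ((norm x)\<^sup>2 - (norm y)\<^sup>2)"

lemma gradient_reg_lagrangian_x:
  assumes "f differentiable (at x)"
  shows "gradient (\<lambda>u. reg_lagrangian f g K e u y) x =
    gradient f x + transpose K *v y + e *\<^sub>R x"
proof (rule gradient_eqI)
  have *: "(K *v u) \<bullet> y = u \<bullet> (transpose K *v y)" for u
    by (metis dot_lmul_matrix inner_commute transpose_matrix_vector)
  have f: "(f has_derivative (\<lambda>h. h \<bullet> gradient f x)) (at x)"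
    using GDERIV_gradient[OF assms] by (simp add: gderiv_def)
  show "GDERIV (\<lambda>u. reg_lagrangian f g K e u y) x :>
    gradient f x + transpose K *v y + e *\<^sub>R x"
    unfolding gderiv_def reg_lagrangian_def lagrangian_def * power2_norm_eq_inner
    by (auto intro!: derivative_eq_intros f
        simp: fun_eq_iff inner_add_right inner_commute algebra_simps)
qed

lemma gradient_reg_lagrangian_y:
  assumes "g differentiable (at y)"
  shows "gradient (\<lambda>v. reg_lagrangian f g K e x v) y =
    - gradient g y + K *v x - e *\<^sub>R y"
proof (rule gradient_eqI)
  have g: "(g has_derivative (\<lambda>h. h \<bullet> gradient g y)) (at y)"
    using GDERIV_gradient[OF assms] by (simp add: gderiv_def)
  show "GDERIV (\<lambda>v. reg_lagrangian f g K e x v) y :>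
    - gradient g y + K *v x - e *\<^sub>R y"
    unfolding gderiv_def reg_lagrangian_def lagrangian_def power2_norm_eq_inner
    by (auto intro!: derivative_eq_intros g
        simp: fun_eq_iff inner_add_right inner_diff_right inner_commute algebra_simps)
qed

text \<open>\<open>C\<^sup>1\<close> on the closed half-line \<open>[t\<^sub>0, \<infinity>)\<close>, one-sided at \<open>t\<^sub>0\<close>, with derivative \<open>f'\<close>.\<close>

definition C1_from :: "real \<Rightarrow> (real \<Rightarrow> real) \<Rightarrow> (real \<Rightarrow> real) \<Rightarrow> bool" where
  "C1_from t0 f f' \<longleftrightarrow>
     (\<forall>t\<ge>t0. (f has_real_derivative f' t) (at t within {t0..})) \<and> continuous_on {t0..} f'"

definition L1_loc :: "real \<Rightarrow> (real \<Rightarrow> 'a::euclidean_space) \<Rightarrow> bool" where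
  "L1_loc t0 u \<longleftrightarrow> (\<forall>T\<ge>t0. u absolutely_integrable_on {t0..T})"

text \<open>\<open>C\<^sup>1\<close> functions with compact support in the open half-line \<open>(t\<^sub>0, \<infinity>)\<close>. Following the
  usual convention for Sobolev spaces in one variable, these (rather than \<open>C\<^sup>\<infinity>\<close> functions) serve
  as test functions; both choices give the same weak derivatives.\<close>

definition test_function :: "real \<Rightarrow> (real \<Rightarrow> real) \<Rightarrow> (real \<Rightarrow> real) \<Rightarrow> bool" where
  "test_function t0 \<phi> \<phi>' \<longleftrightarrow>
     (\<forall>t. (\<phi> has_real_derivative \<phi>' t) (at t)) \<and> continuous_on UNIV \<phi>' \<and>
     (\<exists>a>t0. \<exists>b. \<forall>t. t \<notin> {a..b} \<longrightarrow> \<phi> t = 0)"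

definition weak_derivative ::
  "real \<Rightarrow> (real \<Rightarrow> 'a::euclidean_space) \<Rightarrow> (real \<Rightarrow> 'a) \<Rightarrow> bool" where
  "weak_derivative t0 u v \<longleftrightarrow>
     (\<forall>\<phi> \<phi>'. test_function t0 \<phi> \<phi>' \<longrightarrow>
        integral {t0..} (\<lambda>t. \<phi>' t *\<^sub>R u t) = - integral {t0..} (\<lambda>t. \<phi> t *\<^sub>R v t))"

text \<open>\<open>u \<in> W\<^sup>2\<^sup>,\<^sup>1\<^sub>l\<^sub>o\<^sub>c([t\<^sub>0, \<infinity>))\<close> with first and second weak derivatives \<open>du\<close> and \<open>ddu\<close>.\<close>

definition W21_loc ::
  "real \<Rightarrow> (real \<Rightarrow> 'a::euclidean_space) \<Rightarrow> (real \<Rightarrow> 'a) \<Rightarrow> (real \<Rightarrow> 'a) \<Rightarrow> bool" where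
  "W21_loc t0 u du ddu \<longleftrightarrow>
     L1_loc t0 u \<and> L1_loc t0 du \<and> L1_loc t0 ddu \<and>
     weak_derivative t0 u du \<and> weak_derivative t0 du ddu"

text \<open>Global strong solutions of the system, with velocities \<open>dx\<close> and \<open>dy\<close>. An element of
  \<open>W\<^sup>2\<^sup>,\<^sup>1\<^sub>l\<^sub>o\<^sub>c\<close> is an equivalence class modulo null sets; as usual it is identified with its
  \<open>C\<^sup>1\<close> representative, so that \<open>x\<close>, \<open>dx\<close>, \<open>y\<close>, \<open>dy\<close> are required to be continuous and
  pointwise statements about them make sense. The second derivatives are only determined, and
  only used, almost everywhere.\<close>

definition gtrd_trajectory ::
  "real \<Rightarrow> real \<Rightarrow> (real \<Rightarrow> real) \<Rightarrow> (real \<Rightarrow> real) \<Rightarrow> (real \<Rightarrow> real)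
    \<Rightarrow> (real^'n \<Rightarrow> real) \<Rightarrow> (real^'m \<Rightarrow> real) \<Rightarrow> real^'n^'m
    \<Rightarrow> (real \<Rightarrow> real^'n) \<Rightarrow> (real \<Rightarrow> real^'n) \<Rightarrow> (real \<Rightarrow> real^'m) \<Rightarrow> (real \<Rightarrow> real^'m) \<Rightarrow> bool" where
  "gtrd_trajectory t0 \<theta> \<alpha> \<beta> \<epsilon> f g K x dx y dy \<longleftrightarrow>
     continuous_on {t0..} x \<and> continuous_on {t0..} dx \<and>
     continuous_on {t0..} y \<and> continuous_on {t0..} dy \<and>
     (\<exists>ddx ddy. W21_loc t0 x dx ddx \<and> W21_loc t0 y dy ddy \<and>
       (AE t in lebesgue. t > t0 \<longrightarrow>
          ddx t + \<alpha> t *\<^sub>R dx t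
            + \<beta> t *\<^sub>R gradient (\<lambda>u. reg_lagrangian f g K (\<epsilon> t) u (y t + (\<theta> * t) *\<^sub>R dy t)) (x t) = 0 \<and>
          ddy t + \<alpha> t *\<^sub>R dy t
            - \<beta> t *\<^sub>R gradient (\<lambda>v. reg_lagrangian f g K (\<epsilon> t) (x t + (\<theta> * t) *\<^sub>R dx t) v) (y t) = 0))"

end

theory Submission
  imports Defs
begin

text \<open>
  Write \<open>z = (x, y)\<close>, \<open>\<Phi>(x, y) = f x + g y\<close>, \<open>G = (gradient f, gradient g)\<close> for the gradient of \<open>\<Phi>\<close>, and
  \<open>J(x, y) = (K\<^sup>T y, - K x)\<close>. The system becomes the single equation
  \<open>z'' + \<alpha> z' + \<beta> (G z + J (z + \<theta> t z') + \<epsilon> z) = 0\<close> with \<open>J\<close> skew, and \<open>zs = (xs, ys)\<close> being a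
  saddle point gives \<open>G zs + J zs = 0\<close>. The gap
  \<open>lagrangian f g K x ys - lagrangian f g K xs y\<close> is then the Bregman distance \<open>D(z)\<close> of \<open>\<Phi>\<close> from
  \<open>zs\<close> to \<open>z\<close>.

  The proof differentiates, with \<open>\<zeta> = z - zs + \<theta> t z'\<close>, the energy
  \<open>E = \<theta>\<^sup>2 t\<^sup>2 \<beta> (D(z) + \<epsilon>/2 |z|\<^sup>2) + |\<zeta>|\<^sup>2/2 + (\<theta> t \<alpha> - \<theta> - 1)/2 |z - zs|\<^sup>2\<close>.
  The extrapolation \<open>z + \<theta> t z'\<close> makes the coupling act on \<open>\<zeta> + zs\<close>, so skewness turns it into the constant
  \<open>J zs = - G zs\<close>; the products \<open>(z - zs) \<bullet> z'\<close>, \<open>z \<bullet> z'\<close> and \<open>(G z - G zs) \<bullet> z'\<close> cancel; and what remains is, by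
  convexity, the three parameter inequalities and the monotonicity of \<open>\<epsilon>\<close>,
  \<open>E' \<le> \<theta>/2 t \<beta> \<epsilon> |zs|\<^sup>2 - \<theta>\<^sup>2 t (t \<alpha> - 1/\<theta> - 1) |z'|\<^sup>2 - \<theta> t ((1 - 2 \<theta>) \<beta> - \<theta> t \<beta>') D(z)\<close>
  (\<open>lyapunov_has_real_derivative\<close>, \<open>gtrd_lyapunov_estimates\<close>). As \<open>t \<beta> \<epsilon>\<close> is integrable, \<open>E\<close> is bounded and
  both dissipation terms are integrable (\<open>dissipation_estimate\<close>). A bound on \<open>E\<close> bounds \<open>t\<^sup>2 \<beta> D(z)\<close> and
  \<open>\<zeta>\<close>; a bound on \<open>\<zeta>\<close> bounds \<open>z\<close>, because \<open>t powr (1/\<theta>) (|z - zs|\<^sup>2 - C)\<close> decreases when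
  \<open>|\<zeta>|\<^sup>2 \<le> C\<close>, and then it bounds \<open>t z'\<close>. Gradient differences are controlled by \<open>D\<close> through the
  inequality \<open>convex_lipschitz_gradient_bregman\<close>.

  All this needs \<open>E\<close> to be differentiable. In the equation every term except the second derivative is
  continuous, so the second weak derivative agrees almost everywhere with a continuous function, and a continuous
  function with a continuous weak derivative is classically differentiable
  (\<open>weak_derivative_continuous\<close>).
\<close>

section \<open>Derivatives along curves\<close>

lemma GDERIV_compose_has_real_derivative:
  assumes "GDERIV f (w t) :> D" and "(w has_vector_derivative dw) (at t)"
  shows "((\<lambda>s. f (w s)) has_real_derivative D \<bullet> dw) (at t)"
proof -
  have "(f has_derivative (\<lambda>h. h \<bullet> D)) (at (w t))" using assms(1) by (simp add: gderiv_def)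
  moreover have "(w has_derivative (\<lambda>r. r *\<^sub>R dw)) (at t)"
    using assms(2) by (simp add: has_vector_derivative_def)
  ultimately have "((\<lambda>s. f (w s)) has_derivative (\<lambda>r. (r *\<^sub>R dw) \<bullet> D)) (at t)"
    using has_derivative_compose by blast
  then show ?thesis
    by (simp add: has_field_derivative_def inner_commute mult_commute_abs)
qed

lemma GDERIV_along_line:
  fixes f :: "'a::real_inner \<Rightarrow> real"
  assumes "\<And>z. GDERIV f z :> G z"
  shows "((\<lambda>s. f (x + s *\<^sub>R d)) has_real_derivative G (x + s *\<^sub>R d) \<bullet> d) (at s)"
  by (rule GDERIV_compose_has_real_derivative[OF assms]) (auto intro!: derivative_eq_intros)

lemma norm_square_has_real_derivative:
  fixes w :: "real \<Rightarrow> 'a::real_inner"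
  assumes "(w has_vector_derivative dw) (at t)"
  shows "((\<lambda>s. (norm (w s))\<^sup>2) has_real_derivative 2 * (w t \<bullet> dw)) (at t)"
  using bounded_bilinear.has_vector_derivative[OF bounded_bilinear_inner assms assms]
  by (simp add: has_real_derivative_iff_has_vector_derivative power2_norm_eq_inner inner_commute)

lemma C1_from_continuous_on:
  assumes "C1_from t0 h h'"
  shows "continuous_on {t0..} h"
  using assms DERIV_continuous unfolding C1_from_def continuous_on_eq_continuous_within by blast

lemma C1_from_has_real_derivative:
  assumes "C1_from t0 h h'" and "t > t0"
  shows "(h has_real_derivative h' t) (at t)"
  using assms at_within_interior[of t "{t0..}"]
  by (auto simp: C1_from_def interior_real_atLeast dest: spec[of _ t])

lemma antimono_on_imp_deriv_nonpos:
  fixes f :: "real \<Rightarrow> real"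
  assumes "antimono_on {t0..} f" and "(f has_real_derivative m) (at t)" and "t > t0"
  shows "m \<le> 0"
proof (rule ccontr)
  assume "\<not> m \<le> 0"
  then obtain d where "d > 0" and d: "\<forall>h>0. h < d \<longrightarrow> f t < f (t + h)"
    using DERIV_pos_inc_right[OF assms(2)] by auto
  then have "f t < f (t + d / 2)" by auto
  moreover have "f (t + d / 2) \<le> f t"
    using monotone_onD[OF assms(1), of t "t + d / 2"] \<open>t > t0\<close> \<open>d > 0\<close> by auto
  ultimately show False by simp
qed

section \<open>Convex functions with Lipschitz gradient\<close>

lemma convex_on_above_tangent_plane:
  fixes f :: "'a::real_inner \<Rightarrow> real"
  assumes "convex_on UNIV f" and G: "\<And>z. GDERIV f z :> G z"
  shows "f x + G x \<bullet> (y - x) \<le> f y"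
proof -
  have "convex_on UNIV (\<lambda>s. f (x + s *\<^sub>R (y - x)))"
  proof (rule convex_onI)
    fix t a b :: real assume "0 < t" "t < 1"
    have "x + ((1 - t) *\<^sub>R a + t *\<^sub>R b) *\<^sub>R (y - x)
        = (1 - t) *\<^sub>R (x + a *\<^sub>R (y - x)) + t *\<^sub>R (x + b *\<^sub>R (y - x))"
      by (simp add: algebra_simps)
    then show "f (x + ((1 - t) *\<^sub>R a + t *\<^sub>R b) *\<^sub>R (y - x))
        \<le> (1 - t) * f (x + a *\<^sub>R (y - x)) + t * f (x + b *\<^sub>R (y - x))"
      using convex_onD[OF assms(1), of t "x + a *\<^sub>R (y - x)" "x + b *\<^sub>R (y - x)"]
        \<open>0 < t\<close> \<open>t < 1\<close> by simp
  qed simp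
  from convex_on_imp_above_tangent[OF this, of 0 1 "G x \<bullet> (y - x)"]
    GDERIV_along_line[OF G, of x "y - x" 0]
  show ?thesis by (simp add: connected_UNIV)
qed

lemma lipschitz_gradient_quadratic_upper_bound:
  fixes f :: "'a::real_inner \<Rightarrow> real"
  assumes G: "\<And>z. GDERIV f z :> G z" and lip: "L-lipschitz_on UNIV G"
  shows "f (x + d) \<le> f x + G x \<bullet> d + L / 2 * (norm d)\<^sup>2"
proof -
  define h where "h s = f (x + s *\<^sub>R d) - s * (G x \<bullet> d) - L / 2 * s\<^sup>2 * (norm d)\<^sup>2" for s
  have "h 1 \<le> h 0"
  proof (rule DERIV_nonpos_imp_nonincreasing[where f = h])
    fix s :: real assume s: "0 \<le> s" "s \<le> 1"
    have "(h has_real_derivative (G (x + s *\<^sub>R d) - G x) \<bullet> d - L * s * (norm d)\<^sup>2) (at s)"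
      unfolding h_def
      by (auto intro!: derivative_eq_intros GDERIV_along_line[OF G] simp: inner_diff_left)
    moreover have "(G (x + s *\<^sub>R d) - G x) \<bullet> d \<le> norm (G (x + s *\<^sub>R d) - G x) * norm d"
      by (rule norm_cauchy_schwarz)
    moreover have "\<dots> \<le> (L * s * norm d) * norm d"
      using lipschitz_onD[OF lip, of "x + s *\<^sub>R d" x] s
      by (intro mult_right_mono) (auto simp: dist_norm mult.assoc)
    ultimately show "\<exists>y. (h has_real_derivative y) (at s) \<and> y \<le> 0"
      by (intro exI[of _ "(G (x + s *\<^sub>R d) - G x) \<bullet> d - L * s * (norm d)\<^sup>2"])
        (auto simp: power2_eq_square algebra_simps)
  qed simp
  then show ?thesis by (simp add: h_def)
qed

text \<open>Convexity sharpened by the gradient difference: compare the tangent plane at \<open>u\<close> with the quadratic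
  upper bound at \<open>v\<close>, both evaluated at \<open>w = v - (G v - G u) / L\<close>, the gradient step from \<open>v\<close>
  for the function \<open>f - G u \<bullet> _\<close>, which is minimal at \<open>u\<close>.\<close>

lemma convex_lipschitz_gradient_bregman:
  fixes f :: "'a::real_inner \<Rightarrow> real"
  assumes conv: "convex_on UNIV f" and G: "\<And>z. GDERIV f z :> G z"
    and lip: "L-lipschitz_on UNIV G" and "L > 0"
  shows "f u + G u \<bullet> (v - u) + 1 / (2 * L) * (norm (G u - G v))\<^sup>2 \<le> f v"
proof -
  define p where "p = G v - G u"
  define w where "w = v - (1 / L) *\<^sub>R p"
  have "f u + G u \<bullet> (w - u) \<le> f w"
    by (rule convex_on_above_tangent_plane[OF conv G])
  also have "f w \<le> f v + G v \<bullet> (- (1 / L) *\<^sub>R p) + L / 2 * (norm (- (1 / L) *\<^sub>R p))\<^sup>2"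
    using lipschitz_gradient_quadratic_upper_bound[OF G lip, of v "- (1 / L) *\<^sub>R p"] by (simp add: w_def)
  also have "L / 2 * (norm (- (1 / L) *\<^sub>R p))\<^sup>2 = 1 / (2 * L) * (p \<bullet> p)"
    using \<open>L > 0\<close> unfolding power2_norm_eq_inner by (simp add: field_simps)
  finally have "f u + G u \<bullet> (w - u) \<le> f v - 1 / L * (G v \<bullet> p) + 1 / (2 * L) * (p \<bullet> p)"
    by simp
  moreover have "G u \<bullet> (w - u) = G u \<bullet> (v - u) - 1 / L * (G u \<bullet> p)"
    by (simp add: w_def algebra_simps)
  moreover have "1 / L * (G v \<bullet> p) - 1 / L * (G u \<bullet> p) = 1 / L * (p \<bullet> p)"
    by (simp add: p_def algebra_simps diff_divide_distrib)
  moreover have "1 / (2 * L) * (norm (G u - G v))\<^sup>2 = 1 / (2 * L) * (p \<bullet> p)"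
    by (simp add: p_def power2_norm_eq_inner[symmetric] norm_minus_commute)
  moreover have "1 / L * (p \<bullet> p) = 2 * (1 / (2 * L) * (p \<bullet> p))" by simp
  ultimately show ?thesis by linarith
qed

lemma convex_C1_lipschitz_gradient_bregman:
  fixes f :: "'a::euclidean_space \<Rightarrow> real"
  assumes "convex_C1_lipschitz_gradient L f" and "L > 0"
  shows "f u + gradient f u \<bullet> (v - u) + 1 / (2 * L) * (norm (gradient f u - gradient f v))\<^sup>2 \<le> f v"
  using assms GDERIV_gradient
  by (intro convex_lipschitz_gradient_bregman) (auto simp: convex_C1_lipschitz_gradient_def)

text \<open>The Bregman distance of \<open>\<Phi>\<close> from \<open>zs\<close> to \<open>u\<close>; the gradient \<open>G\<close> of \<open>\<Phi>\<close> is a separate argument.\<close>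

definition bregman :: "('a::real_inner \<Rightarrow> real) \<Rightarrow> ('a \<Rightarrow> 'a) \<Rightarrow> 'a \<Rightarrow> 'a \<Rightarrow> real" where
  "bregman \<Phi> G zs u = \<Phi> u - \<Phi> zs - G zs \<bullet> (u - zs)"

section \<open>Continuous weak derivatives are classical\<close>

lemma continuous_antiderivative:
  fixes f :: "real \<Rightarrow> real"
  assumes "continuous_on UNIV f"
  obtains F where "\<And>t. (F has_real_derivative f t) (at t)"
  using einterval_antiderivative[of "-\<infinity>" "\<infinity>" f] assms
  by (auto simp: continuous_on_eq_continuous_at has_real_derivative_iff_has_vector_derivative)

text \<open>The du Bois-Reymond lemma for continuous functions. Let \<open>k t = (t - a) (b - t)\<close> on \<open>[a, b]\<close> and let
  \<open>c\<close> be the \<open>k\<close>-weighted mean of \<open>W\<close>. Then \<open>k (W - c)\<close> has integral zero, hence is the derivative of an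
  admissible \<open>\<phi>\<close>, and testing with it gives that the integral of \<open>k (W - c)\<^sup>2\<close> vanishes. No mollifiers are
  needed, since test functions are only required to be continuously differentiable.\<close>

lemma constant_if_orthogonal_to_test_derivatives:
  fixes W :: "real \<Rightarrow> real"
  assumes "a < b" and cW: "continuous_on {a..b} W"
    and orth: "\<And>\<phi> \<phi>'. (\<And>t. (\<phi> has_real_derivative \<phi>' t) (at t)) \<Longrightarrow> continuous_on UNIV \<phi>'
        \<Longrightarrow> (\<And>t. t \<notin> {a<..<b} \<Longrightarrow> \<phi> t = 0) \<Longrightarrow> integral {a..b} (\<lambda>t. \<phi>' t * W t) = 0"
  obtains c where "\<And>t. t \<in> {a..b} \<Longrightarrow> W t = c"
proof -
  define k where "k t = max 0 ((t - a) * (b - t))" for t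
  have k0: "k t \<ge> 0" for t by (simp add: k_def)
  have kout: "k t = 0" if "t \<notin> {a<..<b}" for t
    using that \<open>a < b\<close> by (auto simp: k_def mult_le_0_iff intro!: max_absorb1)
  have kpos: "k t > 0" if "t \<in> {a<..<b}" for t
    using that by (auto simp: k_def less_max_iff_disj)
  \<comment> \<open>A continuous extension of \<open>W\<close> to the whole line, so that \<open>p\<close> below is globally continuous.\<close>
  define V where "V t = W (max a (min b t))" for t
  have cV: "continuous_on UNIV V"
    unfolding V_def using \<open>a < b\<close>
    by (intro continuous_on_compose2[OF cW] continuous_intros) auto
  have VW: "V t = W t" if "t \<in> {a..b}" for t
    using that by (simp add: V_def)
  have ck: "continuous_on UNIV k" unfolding k_def by (intro continuous_intros)
  note ints = integrable_continuous_real continuous_on_subset[OF ck] continuous_on_subset[OF cV]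
  have Ik: "integral {a..b} k > 0"
  proof -
    have "integral {a..b} k \<noteq> 0"
      using integral_eq_0_iff[OF continuous_on_subset[OF ck] \<open>a < b\<close>, of] k0 kpos[of "(a+b)/2"] \<open>a < b\<close>
      by force
    moreover have "integral {a..b} k \<ge> 0" by (intro integral_nonneg ints) (auto simp: k0)
    ultimately show ?thesis by simp
  qed
  define c where "c = integral {a..b} (\<lambda>t. k t * V t) / integral {a..b} k"
  define p where "p t = k t * (V t - c)" for t
  have cp: "continuous_on UNIV p" unfolding p_def by (intro continuous_intros ck cV)
  obtain F where F: "\<And>t. (F has_real_derivative p t) (at t)"
    using continuous_antiderivative[OF cp] by blast
  define \<phi> where "\<phi> t = F t - F a" for t
  have d: "(\<phi> has_real_derivative p t) (at t)" for t
    unfolding \<phi>_def using F by (auto intro!: derivative_eq_intros)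
  have ip: "(p has_integral F b - F a) {a..b}"
    using \<open>a < b\<close> F by (intro fundamental_theorem_of_calculus)
      (auto simp: has_real_derivative_iff_has_vector_derivative intro: has_vector_derivative_at_within)
  have "integral {a..b} p = integral {a..b} (\<lambda>t. k t * V t) - c * integral {a..b} k"
  proof -
    have "integral {a..b} p = integral {a..b} (\<lambda>t. k t * V t - c * k t)"
      by (intro integral_cong) (simp add: p_def algebra_simps)
    also have "\<dots> = integral {a..b} (\<lambda>t. k t * V t) - integral {a..b} (\<lambda>t. c * k t)"
      by (intro integral_diff integrable_continuous_real continuous_intros)
        (auto intro: continuous_on_subset[OF ck] continuous_on_subset[OF cV])
    finally show ?thesis by simp
  qed
  also have "\<dots> = 0" using Ik by (simp add: c_def)
  finally have Ip: "integral {a..b} p = 0" .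
  have \<phi>b: "\<phi> b = 0" using ip Ip by (simp add: \<phi>_def integral_unique)
  \<comment> \<open>\<open>\<phi>\<close> is constant on intervals that avoid \<open>(a, b)\<close>, and vanishes at \<open>a\<close> and at \<open>b\<close>.\<close>
  have const: "\<phi> s = \<phi> t" if "s \<le> t" "{s<..<t} \<inter> {a<..<b} = {}" for s t
  proof (cases "s = t")
    case False
    then have "s < t" using that by simp
    show ?thesis
    proof (rule DERIV_isconst2[OF \<open>s < t\<close>, symmetric])
      show "continuous_on {s..t} \<phi>"
        by (meson d DERIV_isCont continuous_at_imp_continuous_on)
      fix r assume "s < r" "r < t"
      then have "r \<notin> {a<..<b}" using that(2) \<open>s < r\<close> \<open>r < t\<close>
        by (metis IntI empty_iff greaterThanLessThan_iff)
      then have "p r = 0" by (simp add: p_def kout)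
      then show "(\<phi> has_real_derivative 0) (at r)" using d[of r] by simp
    qed (use \<open>s < t\<close> in auto)
  qed simp
  have \<phi>out: "\<phi> t = 0" if "t \<notin> {a<..<b}" for t
  proof (cases "t \<le> a")
    case True
    then show ?thesis using const[of t a] by (auto simp: \<phi>_def)
  next
    case False
    then show ?thesis using const[of b t] that \<phi>b by auto
  qed
  have "integral {a..b} (\<lambda>t. p t * W t) = 0" by (rule orth[OF d cp \<phi>out])
  then have "integral {a..b} (\<lambda>t. p t * V t) = 0"
    by (metis (mono_tags, lifting) VW integral_cong)
  have "integral {a..b} (\<lambda>t. k t * (V t - c)\<^sup>2) = integral {a..b} (\<lambda>t. p t * V t - c * p t)"
    by (intro integral_cong) (simp add: p_def power2_eq_square algebra_simps)
  also have "\<dots> = integral {a..b} (\<lambda>t. p t * V t) - integral {a..b} (\<lambda>t. c * p t)"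
    by (intro integral_diff integrable_continuous_real continuous_intros)
      (auto intro: continuous_on_subset[OF cp] continuous_on_subset[OF cV])
  also have "\<dots> = 0" using Ip \<open>integral {a..b} (\<lambda>t. p t * V t) = 0\<close> by simp
  finally have "integral {a..b} (\<lambda>t. k t * (V t - c)\<^sup>2) = 0" .
  moreover have "continuous_on {a..b} (\<lambda>t. k t * (V t - c)\<^sup>2)"
    by (intro continuous_intros) (auto intro: continuous_on_subset[OF ck] continuous_on_subset[OF cV])
  ultimately have "k t * (V t - c)\<^sup>2 = 0" if "t \<in> {a..b}" for t
    using that integral_eq_0_iff[of a b "\<lambda>t. k t * (V t - c)\<^sup>2"] \<open>a < b\<close> k0 by auto
  then have "W t = c" if "t \<in> {a<..<b}" for t
    using that kpos[of t] VW[of t] by (metis atLeastAtMost_iff eq_iff_diff_eq_0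
        greaterThanLessThan_iff less_eq_real_def mult_eq_0_iff order_less_irrefl zero_eq_power2)
  then have "W t = c" if "t \<in> {a..b}" for t
    using continuous_constant_on_closure[of "{a<..<b}" W c t] that cW \<open>a < b\<close> by auto
  then show thesis using that by blast
qed

lemma weak_derivative_continuous:
  fixes u v :: "real \<Rightarrow> 'a::euclidean_space"
  assumes wd: "weak_derivative t0 u v"
    and cu: "continuous_on {t0..} u" and cv: "continuous_on {t0..} v" and "t > t0"
  shows "(u has_vector_derivative v t) (at t)"
proof -
  \<comment> \<open>Test functions must have support away from \<open>t0\<close>, hence \<open>t0 < a\<close>.\<close>
  define a where "a = (t0 + t) / 2"
  define b where "b = t + 1"
  have ab: "t0 < a" "a < t" "t < b" using \<open>t > t0\<close> by (auto simp: a_def b_def)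
  have sub: "{a..b} \<subseteq> {t0..}" using ab by auto
  note cu' = continuous_on_subset[OF cu sub] and cv' = continuous_on_subset[OF cv sub]
  define H where "H s = integral {a..s} v" for s
  have dH: "(H has_vector_derivative v s) (at s within {a..b})" if "s \<in> {a..b}" for s
    unfolding H_def by (rule integral_has_vector_derivative[OF cv' that])
  have cH: "continuous_on {a..b} H"
    by (meson continuous_on_vector_derivative dH)
  \<comment> \<open>Integration by parts with the classical primitive \<open>H\<close> shows that \<open>u - H\<close> has weak derivative zero.\<close>
  have *: "\<exists>c. \<forall>s\<in>{a..b}. (u s - H s) \<bullet> e = c" for e
  proof -
    have "\<exists>c. \<forall>s\<in>{a..b}. (\<lambda>s. (u s - H s) \<bullet> e) s = c"
    proof (rule constant_if_orthogonal_to_test_derivatives[of a b "\<lambda>s. (u s - H s) \<bullet> e"])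
      show "a < b" using ab by simp
      show "continuous_on {a..b} (\<lambda>s. (u s - H s) \<bullet> e)" by (intro continuous_intros cu' cH)
      fix \<phi> \<phi>' :: "real \<Rightarrow> real"
      assume d: "\<And>t. (\<phi> has_real_derivative \<phi>' t) (at t)" and c': "continuous_on UNIV \<phi>'"
        and out: "\<And>t. t \<notin> {a<..<b} \<Longrightarrow> \<phi> t = 0"
      have "test_function t0 \<phi> \<phi>'"
        unfolding test_function_def using d c' out ab by (metis atLeastAtMost_iff greaterThanLessThan_iff less_eq_real_def)
      then have w: "integral {t0..} (\<lambda>t. \<phi>' t *\<^sub>R u t) = - integral {t0..} (\<lambda>t. \<phi> t *\<^sub>R v t)"
        using wd by (auto simp: weak_derivative_def)
      have c: "continuous_on A \<phi>" for A
        by (meson d DERIV_isCont continuous_at_imp_continuous_on)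
      have out': "\<phi>' s = 0" if "s \<notin> {a..b}" for s
      proof -
        have "((\<lambda>_. 0) has_real_derivative \<phi>' s) (at s)"
          by (rule has_field_derivative_transform_within_open[OF d, where S = "- {a..b}"])
            (use that out in auto)
        then show ?thesis by (metis DERIV_const DERIV_unique)
      qed
      have r: "integral {t0..} q = integral {a..b} q" if "\<And>s. s \<notin> {a..b} \<Longrightarrow> q s = 0" for q :: "real \<Rightarrow> 'a"
      proof -
        have "integral {t0..} q = integral {t0..} (\<lambda>s. if s \<in> {a..b} then q s else 0)"
          using that by (intro integral_cong) auto
        also have "\<dots> = integral ({a..b} \<inter> {t0..}) q" by (rule integral_restrict_Int)
        also have "{a..b} \<inter> {t0..} = {a..b}" using sub by blast
        finally show ?thesis .
      qed
      have "integral {t0..} (\<lambda>t. \<phi>' t *\<^sub>R u t) = integral {a..b} (\<lambda>t. \<phi>' t *\<^sub>R u t)"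
        by (rule r) (simp add: out')
      moreover have "integral {t0..} (\<lambda>t. \<phi> t *\<^sub>R v t) = integral {a..b} (\<lambda>t. \<phi> t *\<^sub>R v t)"
        by (rule r) (use out in auto)
      ultimately have w': "integral {a..b} (\<lambda>t. \<phi>' t *\<^sub>R u t) = - integral {a..b} (\<lambda>t. \<phi> t *\<^sub>R v t)"
        using w by simp
      have "((\<lambda>s. \<phi> s *\<^sub>R v s + \<phi>' s *\<^sub>R H s) has_integral (\<phi> b *\<^sub>R H b - \<phi> a *\<^sub>R H a)) {a..b}"
        using ab dH d by (intro fundamental_theorem_of_calculus has_vector_derivative_scaleR)
          (auto intro: has_field_derivative_at_within)
      then have h: "((\<lambda>s. \<phi> s *\<^sub>R v s + \<phi>' s *\<^sub>R H s) has_integral 0) {a..b}" using out by simp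
      have i1: "(\<lambda>t. \<phi>' t *\<^sub>R u t) integrable_on {a..b}"
        and i2: "(\<lambda>t. \<phi> t *\<^sub>R v t) integrable_on {a..b}"
        by (intro integrable_continuous_real continuous_intros cu' cv' c
            continuous_on_subset[OF c' subset_UNIV])+
      have "((\<lambda>t. \<phi>' t *\<^sub>R u t + \<phi> t *\<^sub>R v t - (\<phi> t *\<^sub>R v t + \<phi>' t *\<^sub>R H t)) has_integral
          (integral {a..b} (\<lambda>t. \<phi>' t *\<^sub>R u t) + integral {a..b} (\<lambda>t. \<phi> t *\<^sub>R v t) - 0)) {a..b}"
        by (intro has_integral_diff has_integral_add integrable_integral i1 i2 h)
      then have "((\<lambda>t. \<phi>' t *\<^sub>R (u t - H t)) has_integral 0) {a..b}"
        using w' by (simp add: algebra_simps)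
      from has_integral_linear[OF this bounded_linear_inner_left[of e]]
      show "integral {a..b} (\<lambda>t. \<phi>' t * ((u t - H t) \<bullet> e)) = 0"
        by (simp add: integral_unique o_def)
    qed blast
    then show ?thesis by simp
  qed
  have const: "u s = u t - H t + H s" if "s \<in> {a..b}" for s
  proof -
    have "(u s - H s) \<bullet> e = (u t - H t) \<bullet> e" for e using *[of e] that ab by force
    then have "u s - H s = u t - H t" using vector_eq_rdot by blast
    then show ?thesis by (simp add: algebra_simps)
  qed
  have "((\<lambda>s. u t - H t + H s) has_vector_derivative v t) (at t within {a<..<b})"
    using has_vector_derivative_within_subset[OF dH[of t], of "{a<..<b}"] ab
      greaterThanLessThan_subseteq_atLeastAtMost_iff[of a b a b]
    by (auto intro!: derivative_eq_intros)
  then have "((\<lambda>s. u t - H t + H s) has_vector_derivative v t) (at t)"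
    using ab at_within_open[of t "{a<..<b}"] by auto
  then show ?thesis
  proof (rule has_vector_derivative_transform_within_open[where S = "{a<..<b}"])
    show "t \<in> {a<..<b}" using ab by simp
    show "u t - H t + H s = u s" if "s \<in> {a<..<b}" for s
      using that by (intro const[symmetric]) auto
  qed simp
qed

lemma weak_derivative_AE_eq:
  fixes u v w :: "real \<Rightarrow> 'a::euclidean_space"
  assumes "weak_derivative t0 u v" and "AE t in lebesgue. t > t0 \<longrightarrow> v t = w t"
  shows "weak_derivative t0 u w"
proof -
  obtain N where N: "{t. \<not> (t > t0 \<longrightarrow> v t = w t)} \<subseteq> N" "N \<in> null_sets lebesgue"
    using assms(2) by (auto elim!: AE_E simp: null_sets_def)
  have "integral {t0..} (\<lambda>t. \<phi> t *\<^sub>R w t) = integral {t0..} (\<lambda>t. \<phi> t *\<^sub>R v t)" for \<phi> :: "real \<Rightarrow> real"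
  proof (rule integral_spike)
    show "negligible (insert t0 N)" using N(2) by (simp add: negligible_iff_null_sets)
    show "\<phi> t *\<^sub>R v t = \<phi> t *\<^sub>R w t" if "t \<in> {t0..} - insert t0 N" for t
      using that N(1) by (auto simp: less_le)
  qed
  then show ?thesis using assms(1) by (simp add: weak_derivative_def)
qed

section \<open>Dissipation estimates on a half-line\<close>

lemma nonneg_absolutely_integrable_atLeast:
  fixes q :: "real \<Rightarrow> real"
  assumes cont: "continuous_on {t0..} q" and nonneg: "\<And>t. t \<ge> t0 \<Longrightarrow> q t \<ge> 0"
    and bound: "\<And>T. T \<ge> t0 \<Longrightarrow> integral {t0..T} q \<le> B"
  shows "q absolutely_integrable_on {t0..}"
proof -
  define r where "r k t = (if t \<in> {t0..t0 + real k} then q t else 0)" for k t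
  have I: "{t0..t0 + real k} \<inter> {t0..} = {t0..t0 + real k}" for k by auto
  have cq: "q integrable_on {t0..t0 + real k}" for k
    by (intro integrable_continuous_real continuous_on_subset[OF cont]) auto
  have rint: "integral {t0..} (r k) = integral {t0..t0 + real k} q" for k
    unfolding r_def integral_restrict_Int I ..
  have "q integrable_on {t0..} \<and> ((\<lambda>k. integral {t0..} (r k)) \<longlongrightarrow> integral {t0..} q) sequentially"
  proof (rule monotone_convergence_increasing)
    show "r k integrable_on {t0..}" for k
      unfolding r_def integrable_restrict_Int I by (rule cq)
    show "r k t \<le> r (Suc k) t" if "t \<in> {t0..}" for k t
      using that nonneg[of t] by (auto simp: r_def)
    show "((\<lambda>k. r k t) \<longlongrightarrow> q t) sequentially" if "t \<in> {t0..}" for t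
    proof (rule tendsto_eventually)
      show "eventually (\<lambda>k. r k t = q t) sequentially"
        using eventually_ge_at_top[of "nat \<lceil>t - t0\<rceil>"]
      proof eventually_elim
        case (elim k)
        then have "t - t0 \<le> real k" by linarith
        then show ?case using that by (simp add: r_def)
      qed
    qed
    have "\<bar>integral {t0..} (r k)\<bar> \<le> B" for k
      unfolding rint using bound[of "t0 + real k"] integral_nonneg[OF cq, of k] nonneg by simp
    then show "bounded (range (\<lambda>k. integral {t0..} (r k)))"
      by (auto simp: bounded_iff)
  qed
  then show ?thesis
    by (intro nonnegative_absolutely_integrable_1) (auto intro: nonneg)
qed

lemma absolutely_integrable_atLeast_le:
  fixes p q :: "real \<Rightarrow> real"
  assumes q: "q absolutely_integrable_on {t0..}" and cont: "continuous_on {t0..} p"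
    and "\<And>t. t \<ge> t0 \<Longrightarrow> 0 \<le> p t" "\<And>t. t \<ge> t0 \<Longrightarrow> p t \<le> q t"
  shows "p absolutely_integrable_on {t0..}"
proof (rule nonneg_absolutely_integrable_atLeast[OF cont assms(3)])
  fix T assume "T \<ge> t0"
  have qi: "q integrable_on {t0..}" using q set_lebesgue_integral_eq_integral(1) by blast
  then have qT: "q integrable_on {t0..T}" using integrable_on_subinterval by (metis atLeast_iff atLeastAtMost_iff subsetI)
  have "integral {t0..T} p \<le> integral {t0..T} q"
    using assms(4) by (intro integral_le qT integrable_continuous_real continuous_on_subset[OF cont]) auto
  also have "\<dots> \<le> integral {t0..} q"
    using assms(3,4) qi qT by (intro integral_subset_le) (auto intro: order_trans)
  finally show "integral {t0..T} p \<le> integral {t0..} q" .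
qed

text \<open>A nonnegative energy whose derivative is at most \<open>p - q\<close>, with integrable supply \<open>p\<close>, is bounded, and the
  dissipation \<open>q\<close> is integrable. Differentiability is assumed only in the open half-line.\<close>

lemma dissipation_estimate:
  fixes E D q p :: "real \<Rightarrow> real"
  assumes cE: "continuous_on {t0..} E"
    and dE: "\<And>t. t > t0 \<Longrightarrow> (E has_real_derivative D t) (at t)"
    and diss: "\<And>t. t > t0 \<Longrightarrow> D t + q t \<le> p t"
    and E0: "\<And>t. t \<ge> t0 \<Longrightarrow> E t \<ge> 0"
    and q: "continuous_on {t0..} q" "\<And>t. t \<ge> t0 \<Longrightarrow> q t \<ge> 0"
    and p: "continuous_on {t0..} p" "\<And>t. t \<ge> t0 \<Longrightarrow> p t \<ge> 0" "p absolutely_integrable_on {t0..}"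
  shows "\<exists>B. \<forall>t\<ge>t0. E t \<le> B" and "q absolutely_integrable_on {t0..}"
proof -
  define B where "B = E t0 + integral {t0..} p"
  have pi: "p integrable_on {t0..}" using p(3) set_lebesgue_integral_eq_integral(1) by blast
  have main: "E T + integral {t0..T} q \<le> B" if "T \<ge> t0" for T
  proof -
    have sub: "{t0..T} \<subseteq> {t0..}" by auto
    have cpq: "continuous_on {t0..T} (\<lambda>s. q s - p s)"
      by (intro continuous_intros continuous_on_subset[OF q(1) sub] continuous_on_subset[OF p(1) sub])
    define h where "h t = E t + integral {t0..t} (\<lambda>s. q s - p s)" for t
    have "h T \<le> h t0"
    proof (rule DERIV_nonpos_imp_decreasing_open[OF that, where f = h])
      fix t assume t: "t0 < t" "t < T"
      have "((\<lambda>t. integral {t0..t} (\<lambda>s. q s - p s)) has_vector_derivative q t - p t) (at t within {t0..T})"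
        using t by (intro integral_has_vector_derivative[OF cpq]) auto
      then have "((\<lambda>t. integral {t0..t} (\<lambda>s. q s - p s)) has_real_derivative q t - p t) (at t)"
        using t at_within_interior[of t "{t0..T}"]
        by (simp add: has_real_derivative_iff_has_vector_derivative)
      then have "(h has_real_derivative D t + (q t - p t)) (at t)"
        unfolding h_def using dE[OF t(1)] by (intro DERIV_add)
      then show "\<exists>y. (h has_real_derivative y) (at t) \<and> y \<le> 0" using diss[OF t(1)] by fastforce
    next
      show "continuous_on {t0..T} h" unfolding h_def
        by (intro continuous_intros continuous_on_subset[OF cE sub] indefinite_integral_continuous_1
            integrable_continuous_real cpq)
    qed
    moreover have "integral {t0..T} (\<lambda>s. q s - p s) = integral {t0..T} q - integral {t0..T} p"
      by (intro integral_diff integrable_continuous_real continuous_on_subset[OF q(1) sub]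
          continuous_on_subset[OF p(1) sub])
    moreover have "integral {t0..T} p \<le> integral {t0..} p"
      using p(2) by (intro integral_subset_le pi sub integrable_continuous_real continuous_on_subset[OF p(1) sub]) auto
    ultimately show ?thesis by (simp add: h_def B_def)
  qed
  have "integral {t0..T} q \<ge> 0" if "T \<ge> t0" for T
    using q(2) by (intro integral_nonneg integrable_continuous_real continuous_on_subset[OF q(1)]) auto
  then show "\<exists>B. \<forall>t\<ge>t0. E t \<le> B" using main by (metis add_increasing2 le_add_same_cancel1 order_trans)
  show "q absolutely_integrable_on {t0..}"
    by (rule nonneg_absolutely_integrable_atLeast[OF q, of B]) (use main E0 in force)+
qed

text \<open>The weight \<open>s powr (1/\<theta>)\<close> is an integrating factor: with \<open>\<zeta> = w + \<theta> s w'\<close>, the derivative of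
  \<open>s powr (1/\<theta>) (|w|\<^sup>2 - M)\<close> is at most \<open>(1/\<theta>) s powr (1/\<theta> - 1) (|\<zeta>|\<^sup>2 - M)\<close>, which is nonpositive.\<close>

lemma norm_square_le_if_extrapolation_bounded:
  fixes w dw :: "real \<Rightarrow> 'a::real_inner"
  assumes "t0 > 0" "\<theta> > 0" and cw: "continuous_on {t0..} w"
    and dw: "\<And>t. t > t0 \<Longrightarrow> (w has_vector_derivative dw t) (at t)"
    and M: "\<And>t. t \<ge> t0 \<Longrightarrow> (norm (w t + (\<theta> * t) *\<^sub>R dw t))\<^sup>2 \<le> M" and "t \<ge> t0"
  shows "(norm (w t))\<^sup>2 \<le> M + (norm (w t0))\<^sup>2"
proof -
  define h where "h s = s powr (1 / \<theta>) * (w s \<bullet> w s - M)" for s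
  have "h t \<le> h t0"
  proof (rule DERIV_nonpos_imp_decreasing_open[OF \<open>t \<ge> t0\<close>, where f = h])
    fix s assume s: "t0 < s" "s < t"
    have s0: "s > 0" using s \<open>t0 > 0\<close> by simp
    define z where "z = w s + (\<theta> * s) *\<^sub>R dw s"
    have d: "((\<lambda>s. w s \<bullet> w s) has_real_derivative 2 * (w s \<bullet> dw s)) (at s)"
      using norm_square_has_real_derivative[OF dw[OF s(1)]] by (simp add: power2_norm_eq_inner)
    have "(h has_real_derivative (1 / \<theta>) * s powr (1 / \<theta> - 1) * (w s \<bullet> w s - M)
        + s powr (1 / \<theta>) * (2 * (w s \<bullet> dw s))) (at s)"
      unfolding h_def by (rule derivative_eq_intros d has_real_derivative_powr s0 refl | simp)+
    moreover have "s powr (1 / \<theta>) = s powr (1 / \<theta> - 1) * s"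
      using s0 powr_add[of s "1 / \<theta> - 1" 1] by simp
    then have "(1 / \<theta>) * s powr (1 / \<theta> - 1) * (w s \<bullet> w s - M) + s powr (1 / \<theta>) * (2 * (w s \<bullet> dw s))
       = (1 / \<theta>) * s powr (1 / \<theta> - 1) * (w s \<bullet> w s + 2 * (w s \<bullet> ((\<theta> * s) *\<^sub>R dw s)) - M)"
      using \<open>\<theta> > 0\<close> by (simp add: field_simps)
    moreover have "w s \<bullet> w s + 2 * (w s \<bullet> ((\<theta> * s) *\<^sub>R dw s)) \<le> z \<bullet> z"
      unfolding z_def using \<open>\<theta> > 0\<close> s0 by (simp add: inner_add inner_commute)
    moreover have "z \<bullet> z \<le> M"
      using M[of s] s by (simp add: z_def power2_norm_eq_inner)
    ultimately show "\<exists>y. (h has_real_derivative y) (at s) \<and> y \<le> 0"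
      using \<open>\<theta> > 0\<close> by (auto intro!: exI divide_nonpos_pos mult_nonneg_nonpos)
  next
    show "continuous_on {t0..t} h"
      unfolding h_def using \<open>t0 > 0\<close>
      by (intro continuous_intros continuous_on_subset[OF cw]) auto
  qed
  have "w t \<bullet> w t - M \<le> w t0 \<bullet> w t0"
  proof (cases "w t \<bullet> w t \<le> M")
    case True
    then show ?thesis by (smt (verit) inner_ge_zero)
  next
    case False
    have "t0 powr (1 / \<theta>) * (w t \<bullet> w t - M) \<le> t powr (1 / \<theta>) * (w t \<bullet> w t - M)"
      using False \<open>t0 > 0\<close> \<open>t \<ge> t0\<close> \<open>\<theta> > 0\<close> by (intro mult_right_mono powr_mono2) auto
    also have "\<dots> \<le> t0 powr (1 / \<theta>) * (w t0 \<bullet> w t0 - M)" using \<open>h t \<le> h t0\<close> by (simp add: h_def)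
    finally have "w t \<bullet> w t - M \<le> w t0 \<bullet> w t0 - M" using \<open>t0 > 0\<close> by simp
    moreover have "M \<ge> 0" using M[of t0] by (meson order_refl order_trans zero_le_power2)
    ultimately show ?thesis by simp
  qed
  then show ?thesis by (simp add: power2_norm_eq_inner)
qed

section \<open>The energy of a skew-coupled inertial system\<close>

text \<open>The energy \<open>E\<close> of the introduction, along a curve \<open>z\<close> with velocity \<open>dz\<close>.\<close>

definition lyapunov ::
  "real \<Rightarrow> (real \<Rightarrow> real) \<Rightarrow> (real \<Rightarrow> real) \<Rightarrow> (real \<Rightarrow> real) \<Rightarrow> ('a::real_inner \<Rightarrow> real) \<Rightarrow> ('a \<Rightarrow> 'a)
    \<Rightarrow> 'a \<Rightarrow> (real \<Rightarrow> 'a) \<Rightarrow> (real \<Rightarrow> 'a) \<Rightarrow> real \<Rightarrow> real" where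
  "lyapunov \<theta> \<alpha> \<beta> \<epsilon> \<Phi> G zs z dz t =
     \<theta>\<^sup>2 * t\<^sup>2 * \<beta> t * (bregman \<Phi> G zs (z t) + \<epsilon> t / 2 * (norm (z t))\<^sup>2)
     + 1 / 2 * (norm (z t - zs + (\<theta> * t) *\<^sub>R dz t))\<^sup>2
     + (\<theta> * t * \<alpha> t - \<theta> - 1) / 2 * (norm (z t - zs))\<^sup>2"

text \<open>In the derivative of the energy all products with \<open>dz t\<close> have cancelled except its squared norm.\<close>

lemma lyapunov_has_real_derivative:
  fixes z dz :: "real \<Rightarrow> 'a::real_inner" and J :: "'a \<Rightarrow> 'a"
  assumes G: "\<And>u. GDERIV \<Phi> u :> G u"
    and J: "linear J" "\<And>u. u \<bullet> J u = 0" and opt: "G zs + J zs = 0"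
    and d\<alpha>: "(\<alpha> has_real_derivative d\<alpha>) (at t)" and d\<beta>: "(\<beta> has_real_derivative d\<beta>) (at t)"
    and d\<epsilon>: "(\<epsilon> has_real_derivative d\<epsilon>) (at t)"
    and dz: "(z has_vector_derivative dz t) (at t)"
    and ddz: "(dz has_vector_derivative - \<alpha> t *\<^sub>R dz t
       - \<beta> t *\<^sub>R (G (z t) + J (z t + (\<theta> * t) *\<^sub>R dz t) + \<epsilon> t *\<^sub>R z t)) (at t)"
  shows "(lyapunov \<theta> \<alpha> \<beta> \<epsilon> \<Phi> G zs z dz has_real_derivative
      (\<theta> * t * ((2 * \<theta> - 1) * \<beta> t + \<theta> * t * d\<beta>) * (bregman \<Phi> G zs (z t) + \<epsilon> t / 2 * (norm (z t))\<^sup>2)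
       + \<theta>\<^sup>2 * t\<^sup>2 * \<beta> t * d\<epsilon> / 2 * (norm (z t))\<^sup>2
       + \<theta> * t * (1 + \<theta> - \<theta> * t * \<alpha> t) * (norm (dz t))\<^sup>2
       - \<theta> * t * \<beta> t * ((G (z t) - G zs) \<bullet> (z t - zs) - bregman \<Phi> G zs (z t))
       + \<theta> / 2 * (\<alpha> t + t * d\<alpha> - t * \<beta> t * \<epsilon> t) * (norm (z t - zs))\<^sup>2
       + \<theta> / 2 * (t * \<beta> t * \<epsilon> t) * (norm zs)\<^sup>2)) (at t)"
proof -
  define w q v \<zeta> where "w = z t - zs" and "q = G (z t) - G zs" and "v = dz t"
    and "\<zeta> = w + (\<theta> * t) *\<^sub>R v"
  define a where "a = - \<alpha> t *\<^sub>R v - \<beta> t *\<^sub>R (q + J \<zeta> + \<epsilon> t *\<^sub>R z t)"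
  \<comment> \<open>By the optimality condition, the coupling contributes \<open>J \<zeta>\<close>, orthogonal to \<open>\<zeta>\<close>, and \<open>- G zs\<close>.\<close>
  have "z t + (\<theta> * t) *\<^sub>R dz t = \<zeta> + zs" by (simp add: \<zeta>_def w_def v_def)
  then have "G (z t) + J (z t + (\<theta> * t) *\<^sub>R dz t) = q + J \<zeta> + (G zs + J zs)"
    by (simp add: q_def linear_add[OF J(1)])
  then have ddz': "(dz has_vector_derivative a) (at t)"
    using ddz by (simp add: a_def v_def opt)
  have dw: "((\<lambda>s. z s - zs) has_vector_derivative v) (at t)"
    unfolding v_def using dz by (auto intro!: derivative_eq_intros)
  have d\<zeta>: "((\<lambda>s. z s - zs + (\<theta> * s) *\<^sub>R dz s) has_vector_derivative
      (1 + \<theta>) *\<^sub>R v + (\<theta> * t) *\<^sub>R a) (at t)"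
    unfolding v_def by (rule derivative_eq_intros dz ddz' refl | simp add: algebra_simps)+
  have dB: "((\<lambda>s. bregman \<Phi> G zs (z s)) has_real_derivative q \<bullet> v) (at t)"
  proof -
    have "((\<lambda>s. G zs \<bullet> (z s - zs)) has_real_derivative G zs \<bullet> v) (at t)"
      using bounded_linear.has_vector_derivative[OF bounded_linear_inner_right dw]
      by (simp add: has_real_derivative_iff_has_vector_derivative)
    then show ?thesis
      unfolding bregman_def using GDERIV_compose_has_real_derivative[OF G dz]
      by (auto intro!: derivative_eq_intros simp: q_def v_def inner_diff_left)
  qed
  have raw: "(lyapunov \<theta> \<alpha> \<beta> \<epsilon> \<Phi> G zs z dz has_real_derivative
      (\<theta>\<^sup>2 * (2 * t * \<beta> t + t\<^sup>2 * d\<beta>) * (bregman \<Phi> G zs (z t) + \<epsilon> t / 2 * (norm (z t))\<^sup>2)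
       + \<theta>\<^sup>2 * t\<^sup>2 * \<beta> t * (q \<bullet> v + (d\<epsilon> / 2 * (norm (z t))\<^sup>2 + \<epsilon> t * (z t \<bullet> v)))
       + \<zeta> \<bullet> ((1 + \<theta>) *\<^sub>R v + (\<theta> * t) *\<^sub>R a)
       + (\<theta> * \<alpha> t + \<theta> * t * d\<alpha>) / 2 * (norm w)\<^sup>2 + (\<theta> * t * \<alpha> t - \<theta> - 1) * (w \<bullet> v))) (at t)"
    unfolding lyapunov_def
    by (rule dB d\<alpha> d\<beta> d\<epsilon> norm_square_has_real_derivative[OF dz]
        norm_square_has_real_derivative[OF dw] norm_square_has_real_derivative[OF d\<zeta>]
        DERIV_cdivide derivative_eq_intros refl)+
      (simp add: w_def[symmetric] v_def[symmetric] \<zeta>_def[symmetric] field_simps)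
  have \<zeta>a: "\<zeta> \<bullet> a = - \<alpha> t * (\<zeta> \<bullet> v) - \<beta> t * (\<zeta> \<bullet> q + \<epsilon> t * (\<zeta> \<bullet> z t))"
    unfolding a_def using J(2)[of \<zeta>] by (simp add: inner_diff_right inner_add_right)
  have "\<zeta> \<bullet> ((1 + \<theta>) *\<^sub>R v + (\<theta> * t) *\<^sub>R a) = (1 + \<theta> - \<theta> * t * \<alpha> t) * (\<zeta> \<bullet> v)
      - \<theta> * t * \<beta> t * (\<zeta> \<bullet> q + \<epsilon> t * (\<zeta> \<bullet> z t))"
    unfolding inner_add_right inner_scaleR_right \<zeta>a by (simp add: algebra_simps)
  also have "\<zeta> \<bullet> v = w \<bullet> v + \<theta> * t * (norm v)\<^sup>2"
    by (simp add: \<zeta>_def inner_add_left power2_norm_eq_inner)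
  also have "\<zeta> \<bullet> q = q \<bullet> w + \<theta> * t * (q \<bullet> v)"
    by (simp add: \<zeta>_def inner_add inner_commute)
  also have "\<zeta> \<bullet> z t = w \<bullet> z t + \<theta> * t * (z t \<bullet> v)"
    by (simp add: \<zeta>_def inner_add inner_commute)
  also have "w \<bullet> z t = 1 / 2 * ((norm (z t))\<^sup>2 + (norm w)\<^sup>2 - (norm zs)\<^sup>2)"
    by (simp add: w_def power2_norm_eq_inner inner_diff_left inner_diff_right inner_commute)
  finally have \<zeta>: "\<zeta> \<bullet> ((1 + \<theta>) *\<^sub>R v + (\<theta> * t) *\<^sub>R a)
      = (1 + \<theta> - \<theta> * t * \<alpha> t) * (w \<bullet> v + \<theta> * t * (norm v)\<^sup>2)
       - \<theta> * t * \<beta> t * (q \<bullet> w + \<theta> * t * (q \<bullet> v) + \<epsilon> t * (1 / 2 * ((norm (z t))\<^sup>2 + (norm w)\<^sup>2 - (norm zs)\<^sup>2)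
         + \<theta> * t * (z t \<bullet> v)))" .
  show ?thesis
    by (rule DERIV_cong[OF raw], unfold \<zeta>)
      (simp add: w_def[symmetric] v_def[symmetric] q_def[symmetric] field_simps power2_eq_square)
qed

text \<open>The estimates for a general convex \<open>\<Phi>\<close> and skew coupling \<open>J\<close>; convexity enters as the tangent plane
  inequality.\<close>

lemma gtrd_lyapunov_estimates:
  fixes z dz :: "real \<Rightarrow> 'a::real_inner" and J :: "'a \<Rightarrow> 'a"
  assumes t0: "t0 > 0" and \<theta>: "\<theta> > 0"
    and G: "\<And>u. GDERIV \<Phi> u :> G u"
    and tangent: "\<And>u v. \<Phi> u + G u \<bullet> (v - u) \<le> \<Phi> v"
    and J: "linear J" "\<And>u. u \<bullet> J u = 0" and opt: "G zs + J zs = 0"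
    and pos: "\<And>t. t \<ge> t0 \<Longrightarrow> \<alpha> t > 0 \<and> \<beta> t > 0 \<and> \<epsilon> t > 0"
    and C1: "C1_from t0 \<alpha> d\<alpha>" "C1_from t0 \<beta> d\<beta>" "C1_from t0 \<epsilon> d\<epsilon>"
    and anti: "antimono_on {t0..} \<epsilon>"
    and h1: "\<And>t. t \<ge> t0 \<Longrightarrow> 1 + \<theta> - \<theta> * t * \<alpha> t \<le> 0"
    and h2: "\<And>t. t \<ge> t0 \<Longrightarrow> (2 * \<theta> - 1) * \<beta> t + \<theta> * t * d\<beta> t \<le> 0"
    and h3: "\<And>t. t \<ge> t0 \<Longrightarrow> \<alpha> t + t * d\<alpha> t \<le> t * \<beta> t * \<epsilon> t"
    and int: "(\<lambda>t. t * \<beta> t * \<epsilon> t) absolutely_integrable_on {t0..}"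
    and cz: "continuous_on {t0..} z" and cdz: "continuous_on {t0..} dz"
    and dz: "\<And>t. t > t0 \<Longrightarrow> (z has_vector_derivative dz t) (at t)"
    and ddz: "\<And>t. t > t0 \<Longrightarrow> (dz has_vector_derivative - \<alpha> t *\<^sub>R dz t
       - \<beta> t *\<^sub>R (G (z t) + J (z t + (\<theta> * t) *\<^sub>R dz t) + \<epsilon> t *\<^sub>R z t)) (at t)"
  shows "\<exists>M. \<forall>t\<ge>t0. norm (z t) \<le> M \<and> t * norm (dz t) \<le> M \<and> t\<^sup>2 * \<beta> t * bregman \<Phi> G zs (z t) \<le> M"
    and "(\<lambda>t. t * (t * \<alpha> t - 1 / \<theta> - 1) * (norm (dz t))\<^sup>2) absolutely_integrable_on {t0..}"
    and "(\<lambda>t. ((1 - 2 * \<theta>) * \<beta> t - \<theta> * t * d\<beta> t) * t * bregman \<Phi> G zs (z t))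
      absolutely_integrable_on {t0..}"
proof -
  define E where "E = lyapunov \<theta> \<alpha> \<beta> \<epsilon> \<Phi> G zs z dz"
  define B where "B t = bregman \<Phi> G zs (z t)" for t
  have tpos: "t > 0" if "t \<ge> t0" for t using that t0 by simp
  have B0: "B t \<ge> 0" for t
    using tangent[of zs "z t"] unfolding B_def bregman_def by linarith
  note cont\<alpha> = C1_from_continuous_on[OF C1(1)] and cont\<beta> = C1_from_continuous_on[OF C1(2)]
    and cont\<epsilon> = C1_from_continuous_on[OF C1(3)]
  have contd\<beta>: "continuous_on {t0..} d\<beta>" using C1(2) by (simp add: C1_from_def)
  have "continuous_on UNIV \<Phi>"
    using G by (meson continuous_at_imp_continuous_on gderiv_def has_derivative_continuous)
  then have cB: "continuous_on {t0..} B"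
    unfolding B_def bregman_def
    by (intro continuous_intros cz continuous_on_compose2[OF _ cz]) auto
  have cE: "continuous_on {t0..} E"
    unfolding E_def lyapunov_def B_def[symmetric]
    by (intro continuous_intros cB cz cdz cont\<alpha> cont\<beta> cont\<epsilon>) auto
  define q1 where "q1 t = t * (t * \<alpha> t - 1 / \<theta> - 1) * (norm (dz t))\<^sup>2" for t
  define q2 where "q2 t = ((1 - 2 * \<theta>) * \<beta> t - \<theta> * t * d\<beta> t) * t * B t" for t
  have cq1: "continuous_on {t0..} q1"
    unfolding q1_def by (intro continuous_intros cdz cont\<alpha>)
  have cq2: "continuous_on {t0..} q2"
    unfolding q2_def by (intro continuous_intros cB cont\<beta> contd\<beta>)
  have q1: "q1 t \<ge> 0" if "t \<ge> t0" for t
  proof -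
    have "t * \<alpha> t - 1 / \<theta> - 1 \<ge> 0" using h1[OF that] \<theta> by (simp add: field_simps)
    then show ?thesis using tpos[OF that] by (simp add: q1_def)
  qed
  have q2: "q2 t \<ge> 0" if "t \<ge> t0" for t
  proof -
    have "(1 - 2 * \<theta>) * \<beta> t - \<theta> * t * d\<beta> t \<ge> 0" using h2[OF that] by (simp add: algebra_simps)
    then show ?thesis using tpos[OF that] B0[of t] by (simp add: q2_def)
  qed
  define p where "p t = \<theta> / 2 * (norm zs)\<^sup>2 * (t * \<beta> t * \<epsilon> t)" for t
  have cp: "continuous_on {t0..} p"
    unfolding p_def by (intro continuous_intros cont\<beta> cont\<epsilon>)
  have p0: "p t \<ge> 0" if "t \<ge> t0" for t
    unfolding p_def using tpos[OF that] pos[OF that] \<theta> by simp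
  have pint: "p absolutely_integrable_on {t0..}"
    unfolding p_def using set_integrable_mult_right[OF int] by auto
  define E' where "E' t = (\<theta> * t * ((2 * \<theta> - 1) * \<beta> t + \<theta> * t * d\<beta> t) * (B t + \<epsilon> t / 2 * (norm (z t))\<^sup>2)
       + \<theta>\<^sup>2 * t\<^sup>2 * \<beta> t * d\<epsilon> t / 2 * (norm (z t))\<^sup>2
       + \<theta> * t * (1 + \<theta> - \<theta> * t * \<alpha> t) * (norm (dz t))\<^sup>2
       - \<theta> * t * \<beta> t * ((G (z t) - G zs) \<bullet> (z t - zs) - B t)
       + \<theta> / 2 * (\<alpha> t + t * d\<alpha> t - t * \<beta> t * \<epsilon> t) * (norm (z t - zs))\<^sup>2
       + \<theta> / 2 * (t * \<beta> t * \<epsilon> t) * (norm zs)\<^sup>2)" for t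
  have dE: "(E has_real_derivative E' t) (at t)" if "t > t0" for t
    unfolding E_def E'_def B_def
    by (intro lyapunov_has_real_derivative[OF G J opt] C1_from_has_real_derivative[OF C1(1)]
        C1_from_has_real_derivative[OF C1(2)] C1_from_has_real_derivative[OF C1(3)] dz ddz that)
  \<comment> \<open>Of the six terms of \<open>E'\<close>, the first and the third contain the dissipation, the second and the fifth are
    nonpositive by the monotonicity of \<open>\<epsilon>\<close> and by \<open>h3\<close>, the fourth by convexity, and the last is \<open>p\<close>.\<close>
  have diss: "E' t + (\<theta>\<^sup>2 * q1 t + \<theta> * q2 t) \<le> p t" if "t > t0" for t
  proof -
    have t: "t \<ge> t0" "t > 0" "\<beta> t > 0" "\<epsilon> t > 0" using that pos[of t] tpos[of t] by auto
    have e1: "\<theta> * t * (1 + \<theta> - \<theta> * t * \<alpha> t) * (norm (dz t))\<^sup>2 = - (\<theta>\<^sup>2 * q1 t)"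
      using \<theta> by (simp add: q1_def field_simps power2_eq_square)
    have e2: "\<theta> * t * ((2 * \<theta> - 1) * \<beta> t + \<theta> * t * d\<beta> t) * (B t + \<epsilon> t / 2 * (norm (z t))\<^sup>2)
        = - (\<theta> * q2 t) + \<theta> * t * (\<epsilon> t / 2 * (norm (z t))\<^sup>2) * ((2 * \<theta> - 1) * \<beta> t + \<theta> * t * d\<beta> t)"
      by (simp add: q2_def field_simps)
    have n1: "\<theta> * t * (\<epsilon> t / 2 * (norm (z t))\<^sup>2) * ((2 * \<theta> - 1) * \<beta> t + \<theta> * t * d\<beta> t) \<le> 0"
      using t \<theta> h2[OF t(1)] by (intro mult_nonneg_nonpos) auto
    have "d\<epsilon> t \<le> 0"
      by (rule antimono_on_imp_deriv_nonpos[OF anti C1_from_has_real_derivative[OF C1(3) that] that])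
    then have "\<theta>\<^sup>2 * t\<^sup>2 * \<beta> t * d\<epsilon> t \<le> 0"
      using t by (intro mult_nonneg_nonpos) auto
    then have n2: "\<theta>\<^sup>2 * t\<^sup>2 * \<beta> t * d\<epsilon> t / 2 * (norm (z t))\<^sup>2 \<le> 0"
      by (intro mult_nonpos_nonneg) auto
    have "(G (z t) - G zs) \<bullet> (z t - zs) - B t \<ge> 0"
      using tangent[of "z t" zs] by (simp add: B_def bregman_def inner_diff_left inner_diff_right)
    then have n3: "\<theta> * t * \<beta> t * ((G (z t) - G zs) \<bullet> (z t - zs) - B t) \<ge> 0"
      using t \<theta> by simp
    have "\<theta> / 2 * (\<alpha> t + t * d\<alpha> t - t * \<beta> t * \<epsilon> t) \<le> 0"
      using h3[OF t(1)] \<theta> by (intro mult_nonneg_nonpos) auto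
    then have n4: "\<theta> / 2 * (\<alpha> t + t * d\<alpha> t - t * \<beta> t * \<epsilon> t) * (norm (z t - zs))\<^sup>2 \<le> 0"
      by (rule mult_nonpos_nonneg) simp
    have "\<theta> / 2 * (t * \<beta> t * \<epsilon> t) * (norm zs)\<^sup>2 = p t" by (simp add: p_def)
    then show ?thesis unfolding E'_def e1 e2 using n1 n2 n3 n4 by linarith
  qed
  define \<zeta> where "\<zeta> t = z t - zs + (\<theta> * t) *\<^sub>R dz t" for t
  have parts: "\<theta>\<^sup>2 * t\<^sup>2 * \<beta> t * B t + 1 / 2 * (norm (\<zeta> t))\<^sup>2 \<le> E t"
    "\<theta>\<^sup>2 * t\<^sup>2 * \<beta> t * B t \<ge> 0" if "t \<ge> t0" for t
  proof -
    have "\<theta>\<^sup>2 * t\<^sup>2 * \<beta> t * (\<epsilon> t / 2 * (norm (z t))\<^sup>2) \<ge> 0"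
      using pos[OF that] by simp
    moreover have "(\<theta> * t * \<alpha> t - \<theta> - 1) / 2 * (norm (z t - zs))\<^sup>2 \<ge> 0"
      using h1[OF that] by simp
    ultimately show "\<theta>\<^sup>2 * t\<^sup>2 * \<beta> t * B t + 1 / 2 * (norm (\<zeta> t))\<^sup>2 \<le> E t"
      unfolding E_def lyapunov_def B_def[symmetric] \<zeta>_def by (simp add: distrib_left)
    show "\<theta>\<^sup>2 * t\<^sup>2 * \<beta> t * B t \<ge> 0" using pos[OF that] B0[of t] by simp
  qed
  have E0: "E t \<ge> 0" if "t \<ge> t0" for t
    using parts[OF that] zero_le_power2[of "norm (\<zeta> t)"] by linarith
  have cq: "continuous_on {t0..} (\<lambda>t. \<theta>\<^sup>2 * q1 t + \<theta> * q2 t)"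
    by (intro continuous_intros cq1 cq2)
  have q0: "\<theta>\<^sup>2 * q1 t + \<theta> * q2 t \<ge> 0" if "t \<ge> t0" for t
    using q1[OF that] q2[OF that] \<theta> by simp
  note est = dissipation_estimate[OF cE dE diss E0 cq q0 cp p0 pint]
  show "(\<lambda>t. t * (t * \<alpha> t - 1 / \<theta> - 1) * (norm (dz t))\<^sup>2) absolutely_integrable_on {t0..}"
  proof -
    have "(\<lambda>t. \<theta>\<^sup>2 * q1 t) absolutely_integrable_on {t0..}"
      by (rule absolutely_integrable_atLeast_le[OF est(2)])
        (use q1 q2 \<theta> in \<open>auto intro!: continuous_intros cq1\<close>)
    from set_integrable_mult_right[OF this, of "1 / \<theta>\<^sup>2"] show ?thesis
      using \<theta> by (simp add: q1_def)
  qed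
  show "(\<lambda>t. ((1 - 2 * \<theta>) * \<beta> t - \<theta> * t * d\<beta> t) * t * bregman \<Phi> G zs (z t))
      absolutely_integrable_on {t0..}"
  proof -
    have "(\<lambda>t. \<theta> * q2 t) absolutely_integrable_on {t0..}"
      by (rule absolutely_integrable_atLeast_le[OF est(2)])
        (use q1 q2 \<theta> in \<open>auto intro!: continuous_intros cq2\<close>)
    from set_integrable_mult_right[OF this, of "1 / \<theta>"] show ?thesis
      using \<theta> by (simp add: q2_def B_def)
  qed
  obtain C where C: "\<And>t. t \<ge> t0 \<Longrightarrow> E t \<le> C" using est(1) by blast
  have \<zeta>C: "(norm (\<zeta> t))\<^sup>2 \<le> 2 * C" if "t \<ge> t0" for t
    using parts[OF that] C[OF that] by linarith
  have BC: "t\<^sup>2 * \<beta> t * B t \<le> C / \<theta>\<^sup>2" if "t \<ge> t0" for t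
  proof -
    have "\<theta>\<^sup>2 * (t\<^sup>2 * \<beta> t * B t) \<le> C"
      using parts[OF that] C[OF that] zero_le_power2[of "norm (\<zeta> t)"]
      unfolding mult.assoc by linarith
    then show ?thesis using \<theta> by (simp add: field_simps)
  qed
  define R where "R = sqrt (2 * C + (norm (z t0 - zs))\<^sup>2)"
  have wR: "norm (z t - zs) \<le> R" if "t \<ge> t0" for t
    unfolding R_def
  proof (rule real_le_rsqrt, rule norm_square_le_if_extrapolation_bounded[OF t0 \<theta> _ _ _ that])
    show "continuous_on {t0..} (\<lambda>t. z t - zs)" by (intro continuous_intros cz)
    show "((\<lambda>t. z t - zs) has_vector_derivative dz t) (at t)" if "t > t0" for t
      using dz[OF that] by (auto intro!: derivative_eq_intros)
    show "(norm (z t - zs + (\<theta> * t) *\<^sub>R dz t))\<^sup>2 \<le> 2 * C" if "t \<ge> t0" for t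
      using \<zeta>C[OF that] by (simp add: \<zeta>_def)
  qed
  have vR: "t * norm (dz t) \<le> (sqrt (2 * C) + R) / \<theta>" if "t \<ge> t0" for t
  proof -
    have "\<theta> * t * norm (dz t) = norm (\<zeta> t - (z t - zs))"
      using \<theta> tpos[OF that] by (simp add: \<zeta>_def)
    also have "\<dots> \<le> norm (\<zeta> t) + norm (z t - zs)" by (rule norm_triangle_ineq4)
    also have "\<dots> \<le> sqrt (2 * C) + R"
      by (intro add_mono wR[OF that] real_le_rsqrt \<zeta>C[OF that])
    finally show ?thesis using \<theta> by (simp add: field_simps)
  qed
  define M where "M = max (norm zs + R) (max ((sqrt (2 * C) + R) / \<theta>) (C / \<theta>\<^sup>2))"
  have "norm (z t) \<le> M" if "t \<ge> t0" for t
    using wR[OF that] norm_triangle_sub[of "z t" zs] by (simp add: M_def)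
  then show "\<exists>M. \<forall>t\<ge>t0. norm (z t) \<le> M \<and> t * norm (dz t) \<le> M \<and> t\<^sup>2 * \<beta> t * bregman \<Phi> G zs (z t) \<le> M"
    using vR BC by (intro exI[of _ M]) (auto simp: M_def B_def le_max_iff_disj)
qed

section \<open>Saddle points and trajectories of the primal-dual system\<close>

lemma GDERIV_zero_at_minimum:
  assumes "GDERIV h u :> D" and "\<And>v. h u \<le> h v"
  shows "D = 0"
proof -
  have "(\<lambda>k. k \<bullet> D) = (\<lambda>k. 0)"
    using assms differential_zero_maxmin[of u UNIV h "\<lambda>k. k \<bullet> D"] by (auto simp: gderiv_def)
  then have "D \<bullet> D = 0" by metis
  then show ?thesis by simp
qed

lemma GDERIV_inner_right: "GDERIV (\<lambda>u. u \<bullet> p) u :> p"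
  unfolding gderiv_def by (auto intro!: derivative_eq_intros)

lemma matrix_inner_transpose: "((K::real^'n^'m) *v u) \<bullet> v = u \<bullet> (transpose K *v v)"
  by (metis dot_lmul_matrix inner_commute transpose_matrix_vector)

lemma saddle_point_stationary:
  fixes f :: "real^'n \<Rightarrow> real" and g :: "real^'m \<Rightarrow> real"
  assumes f: "f differentiable (at xs)" and g: "g differentiable (at ys)"
    and saddle: "(xs, ys) \<in> saddle_points f g K"
  shows "gradient f xs = - (transpose K *v ys)" and "gradient g ys = K *v xs"
proof -
  have "gradient f xs + transpose K *v ys = 0"
  proof (rule GDERIV_zero_at_minimum)
    show "GDERIV (\<lambda>u. f u + u \<bullet> (transpose K *v ys)) xs :> gradient f xs + transpose K *v ys"
      by (intro GDERIV_add GDERIV_gradient[OF f] GDERIV_inner_right)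
    show "f xs + xs \<bullet> (transpose K *v ys) \<le> f u + u \<bullet> (transpose K *v ys)" for u
      using saddle by (simp add: saddle_points_def lagrangian_def matrix_inner_transpose)
  qed
  then show "gradient f xs = - (transpose K *v ys)" by (simp add: add_eq_0_iff2)
  have "gradient g ys - K *v xs = 0"
  proof (rule GDERIV_zero_at_minimum)
    show "GDERIV (\<lambda>v. g v - v \<bullet> (K *v xs)) ys :> gradient g ys - K *v xs"
      by (intro GDERIV_diff GDERIV_gradient[OF g] GDERIV_inner_right)
    show "g ys - ys \<bullet> (K *v xs) \<le> g v - v \<bullet> (K *v xs)" for v
      using saddle by (simp add: saddle_points_def lagrangian_def inner_commute)
        (smt (verit))
  qed
  then show "gradient g ys = K *v xs" by simp
qed

text \<open>A strong solution is twice differentiable in the classical sense on the open half-line.\<close>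

lemma gtrd_trajectory_classical:
  fixes f :: "real^'n \<Rightarrow> real" and g :: "real^'m \<Rightarrow> real"
  assumes f: "\<And>u. f differentiable (at u)" "continuous_on UNIV (gradient f)"
    and g: "\<And>v. g differentiable (at v)" "continuous_on UNIV (gradient g)"
    and c: "continuous_on {t0..} \<alpha>" "continuous_on {t0..} \<beta>" "continuous_on {t0..} \<epsilon>"
    and traj: "gtrd_trajectory t0 \<theta> \<alpha> \<beta> \<epsilon> f g K x dx y dy" and t: "t > t0"
  shows "(x has_vector_derivative dx t) (at t)" and "(y has_vector_derivative dy t) (at t)"
    and "(dx has_vector_derivative - \<alpha> t *\<^sub>R dx t - \<beta> t *\<^sub>R
       (gradient f (x t) + transpose K *v (y t + (\<theta> * t) *\<^sub>R dy t) + \<epsilon> t *\<^sub>R x t)) (at t)"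
    and "(dy has_vector_derivative - \<alpha> t *\<^sub>R dy t - \<beta> t *\<^sub>R
       (gradient g (y t) - K *v (x t + (\<theta> * t) *\<^sub>R dx t) + \<epsilon> t *\<^sub>R y t)) (at t)"
proof -
  obtain ddx ddy where cx: "continuous_on {t0..} x" "continuous_on {t0..} dx"
    and cy: "continuous_on {t0..} y" "continuous_on {t0..} dy"
    and W: "W21_loc t0 x dx ddx" "W21_loc t0 y dy ddy"
    and AE: "AE t in lebesgue. t > t0 \<longrightarrow>
          ddx t + \<alpha> t *\<^sub>R dx t
            + \<beta> t *\<^sub>R gradient (\<lambda>u. reg_lagrangian f g K (\<epsilon> t) u (y t + (\<theta> * t) *\<^sub>R dy t)) (x t) = 0 \<and>
          ddy t + \<alpha> t *\<^sub>R dy t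
            - \<beta> t *\<^sub>R gradient (\<lambda>v. reg_lagrangian f g K (\<epsilon> t) (x t + (\<theta> * t) *\<^sub>R dx t) v) (y t) = 0"
    using traj unfolding gtrd_trajectory_def by blast
  note cf = continuous_on_compose2[OF f(2) cx(1) subset_UNIV]
    and cg = continuous_on_compose2[OF g(2) cy(1) subset_UNIV]
  have mv: "continuous_on S (\<lambda>s. A *v h s)" if "continuous_on S h" for S h and A :: "real^'p^'q"
    by (rule bounded_linear.continuous_on[OF matrix_vector_mul_bounded_linear that])
  define ax where "ax t = - \<alpha> t *\<^sub>R dx t - \<beta> t *\<^sub>R
       (gradient f (x t) + transpose K *v (y t + (\<theta> * t) *\<^sub>R dy t) + \<epsilon> t *\<^sub>R x t)" for t
  define ay where "ay t = - \<alpha> t *\<^sub>R dy t - \<beta> t *\<^sub>R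
       (gradient g (y t) - K *v (x t + (\<theta> * t) *\<^sub>R dx t) + \<epsilon> t *\<^sub>R y t)" for t
  have cax: "continuous_on {t0..} ax"
    unfolding ax_def by (intro continuous_intros cx cy c cf mv)
  have cay: "continuous_on {t0..} ay"
    unfolding ay_def by (intro continuous_intros cx cy c cg mv)
  have "AE t in lebesgue. t > t0 \<longrightarrow> ddx t = ax t"
    using AE by eventually_elim
      (auto simp: ax_def gradient_reg_lagrangian_x[OF f(1)] algebra_simps eq_neg_iff_add_eq_0)
  then have wx: "weak_derivative t0 dx ax"
    using W(1) weak_derivative_AE_eq by (auto simp: W21_loc_def)
  have "AE t in lebesgue. t > t0 \<longrightarrow> ddy t = ay t"
    using AE by eventually_elim
      (auto simp: ay_def gradient_reg_lagrangian_y[OF g(1)] algebra_simps eq_neg_iff_add_eq_0)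
  then have wy: "weak_derivative t0 dy ay"
    using W(2) weak_derivative_AE_eq by (auto simp: W21_loc_def)
  show "(x has_vector_derivative dx t) (at t)" "(y has_vector_derivative dy t) (at t)"
    using W by (auto simp: W21_loc_def intro!: weak_derivative_continuous cx cy t)
  show "(dx has_vector_derivative - \<alpha> t *\<^sub>R dx t - \<beta> t *\<^sub>R
       (gradient f (x t) + transpose K *v (y t + (\<theta> * t) *\<^sub>R dy t) + \<epsilon> t *\<^sub>R x t)) (at t)"
    using weak_derivative_continuous[OF wx cx(2) cax t] by (simp add: ax_def)
  show "(dy has_vector_derivative - \<alpha> t *\<^sub>R dy t - \<beta> t *\<^sub>R
       (gradient g (y t) - K *v (x t + (\<theta> * t) *\<^sub>R dx t) + \<epsilon> t *\<^sub>R y t)) (at t)"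
    using weak_derivative_continuous[OF wy cy(2) cay t] by (simp add: ay_def)
qed

theorem theorem3p1:
  fixes f :: "real^'n \<Rightarrow> real" and g :: "real^'m \<Rightarrow> real" and K :: "real^'n^'m"
    and L1 L2 t0 \<theta> :: real
    and \<alpha> \<beta> \<epsilon> d\<alpha> d\<beta> d\<epsilon> :: "real \<Rightarrow> real"
    and x dx :: "real \<Rightarrow> real^'n" and y dy :: "real \<Rightarrow> real^'m"
    and xs :: "real^'n" and ys :: "real^'m"
  assumes "L1 > 0" and "L2 > 0"
    and "convex_C1_lipschitz_gradient L1 f"
    and "convex_C1_lipschitz_gradient L2 g"
    and "t0 > 0" and "\<theta> > 0"
    and "\<forall>t\<ge>t0. \<alpha> t > 0 \<and> \<beta> t > 0 \<and> \<epsilon> t > 0"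
    and "C1_from t0 \<alpha> d\<alpha>" and "C1_from t0 \<beta> d\<beta>" and "C1_from t0 \<epsilon> d\<epsilon>"
    and "antimono_on {t0..} \<epsilon>" and "(\<epsilon> \<longlongrightarrow> 0) at_top"
    and "\<forall>t\<ge>t0. 1 + \<theta> - \<theta> * t * \<alpha> t \<le> 0"
    and "\<forall>t\<ge>t0. (2 * \<theta> - 1) * \<beta> t + \<theta> * t * d\<beta> t \<le> 0"
    and "\<forall>t\<ge>t0. \<alpha> t + t * d\<alpha> t \<le> t * \<beta> t * \<epsilon> t"
    and "filterlim (\<lambda>t. t\<^sup>2 * \<beta> t) at_top at_top"
    and "(\<lambda>t. t * \<beta> t * \<epsilon> t) absolutely_integrable_on {t0..}"
    and "gtrd_trajectory t0 \<theta> \<alpha> \<beta> \<epsilon> f g K x dx y dy"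
    and "(xs, ys) \<in> saddle_points f g K"
  shows "bounded ((\<lambda>t. (x t, y t)) ` {t0..})
    \<and> (\<lambda>t. lagrangian f g K (x t) ys - lagrangian f g K xs (y t))
        \<in> O[at_top](\<lambda>t. 1 / (t\<^sup>2 * \<beta> t))
    \<and> (\<lambda>t. norm (dx t)) \<in> O[at_top](\<lambda>t. 1 / t)
    \<and> (\<lambda>t. norm (dy t)) \<in> O[at_top](\<lambda>t. 1 / t)
    \<and> (\<lambda>t. norm (gradient f (x t) - gradient f xs)) \<in> O[at_top](\<lambda>t. 1 / (t * sqrt (\<beta> t)))
    \<and> (\<lambda>t. norm (gradient g (y t) - gradient g ys)) \<in> O[at_top](\<lambda>t. 1 / (t * sqrt (\<beta> t)))
    \<and> ((\<forall>t\<ge>t0. 1 + \<theta> - \<theta> * t * \<alpha> t < 0) \<longrightarrow>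
        (\<lambda>t. t * (t * \<alpha> t - 1 / \<theta> - 1) * ((norm (dx t))\<^sup>2 + (norm (dy t))\<^sup>2))
          absolutely_integrable_on {t0..})
    \<and> ((\<forall>t\<ge>t0. (2 * \<theta> - 1) * \<beta> t + \<theta> * t * d\<beta> t < 0) \<longrightarrow>
        (\<lambda>t. ((1 - 2 * \<theta>) * \<beta> t - \<theta> * t * d\<beta> t) * t
               * (lagrangian f g K (x t) ys - lagrangian f g K xs (y t)))
          absolutely_integrable_on {t0..}
      \<and> (\<lambda>t. ((1 - 2 * \<theta>) * \<beta> t - \<theta> * t * d\<beta> t) * t
               * (norm (gradient f (x t) - gradient f xs))\<^sup>2)
          absolutely_integrable_on {t0..}
      \<and> (\<lambda>t. ((1 - 2 * \<theta>) * \<beta> t - \<theta> * t * d\<beta> t) * t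
               * (norm (gradient g (y t) - gradient g ys))\<^sup>2)
          absolutely_integrable_on {t0..})"
proof -
  note t0 = \<open>t0 > 0\<close> and \<theta> = \<open>\<theta> > 0\<close>
  have pos: "\<alpha> t > 0" "\<beta> t > 0" "\<epsilon> t > 0" "t > 0" if "t \<ge> t0" for t
    using assms(7) that t0 by auto
  have f: "\<And>u. f differentiable (at u)" and cf: "continuous_on UNIV (gradient f)"
    and g: "\<And>v. g differentiable (at v)" and cg: "continuous_on UNIV (gradient g)"
    using assms(3,4) by (auto simp: convex_C1_lipschitz_gradient_def)
  have Gf: "(f has_derivative (\<lambda>h. h \<bullet> gradient f u)) (at u)" for u
    using GDERIV_gradient[OF f] by (simp add: gderiv_def)
  have Gg: "(g has_derivative (\<lambda>h. h \<bullet> gradient g v)) (at v)" for v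
    using GDERIV_gradient[OF g] by (simp add: gderiv_def)
  note c\<alpha> = C1_from_continuous_on[OF assms(8)] and c\<beta> = C1_from_continuous_on[OF assms(9)]
    and c\<epsilon> = C1_from_continuous_on[OF assms(10)]
  have cd\<beta>: "continuous_on {t0..} d\<beta>" using assms(9) by (simp add: C1_from_def)
  have cx: "continuous_on {t0..} x" "continuous_on {t0..} dx"
    and cy: "continuous_on {t0..} y" "continuous_on {t0..} dy"
    using assms(18) by (auto simp: gtrd_trajectory_def)
  note traj = gtrd_trajectory_classical[OF f cf g cg c\<alpha> c\<beta> c\<epsilon> assms(18)]
  note stat = saddle_point_stationary[OF f g assms(19)]

  \<comment> \<open>The system as one equation in the product space.\<close>
  define \<Phi> where "\<Phi> u = f (fst u) + g (snd u)" for u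
  define G where "G u = (gradient f (fst u), gradient g (snd u))" for u
  define J where "J u = (transpose K *v snd u, - (K *v fst u))" for u
  define z where "z t = (x t, y t)" for t
  define dz where "dz t = (dx t, dy t)" for t
  define c where "c = min (1 / (2 * L1)) (1 / (2 * L2))"
  have c: "c > 0" using assms(1,2) by (simp add: c_def)
  have G: "GDERIV \<Phi> u :> G u" for u
  proof -
    have "((\<lambda>u. f (fst u)) has_derivative (\<lambda>h. fst h \<bullet> gradient f (fst u))) (at u)"
      by (rule has_derivative_compose[OF _ Gf]) (auto intro!: derivative_eq_intros)
    moreover have "((\<lambda>u. g (snd u)) has_derivative (\<lambda>h. snd h \<bullet> gradient g (snd u))) (at u)"
      by (rule has_derivative_compose[OF _ Gg]) (auto intro!: derivative_eq_intros)
    ultimately have "(\<Phi> has_derivative (\<lambda>h. fst h \<bullet> gradient f (fst u) + snd h \<bullet> gradient g (snd u))) (at u)"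
      unfolding \<Phi>_def by (rule has_derivative_add)
    then show ?thesis by (simp add: gderiv_def G_def inner_prod_def)
  qed
  have norm_G: "(norm (G u - G v))\<^sup>2 = (norm (gradient f (fst u) - gradient f (fst v)))\<^sup>2
      + (norm (gradient g (snd u) - gradient g (snd v)))\<^sup>2" for u v
    by (simp add: G_def norm_Pair)
  have breg: "\<Phi> u + G u \<bullet> (v - u) + c * (norm (G u - G v))\<^sup>2 \<le> \<Phi> v" for u v
  proof -
    have "c * (norm (gradient f (fst u) - gradient f (fst v)))\<^sup>2
        \<le> 1 / (2 * L1) * (norm (gradient f (fst u) - gradient f (fst v)))\<^sup>2"
      "c * (norm (gradient g (snd u) - gradient g (snd v)))\<^sup>2
        \<le> 1 / (2 * L2) * (norm (gradient g (snd u) - gradient g (snd v)))\<^sup>2"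
      by (intro mult_right_mono; simp add: c_def)+
    then show ?thesis
      using convex_C1_lipschitz_gradient_bregman[OF assms(3,1), of "fst u" "fst v"]
        convex_C1_lipschitz_gradient_bregman[OF assms(4,2), of "snd u" "snd v"]
      unfolding norm_G distrib_left by (simp add: \<Phi>_def G_def inner_prod_def)
  qed
  have linJ: "linear J"
    by (rule linearI) (auto simp: J_def matrix_vector_right_distrib matrix_vector_mult_scaleR)
  have skew: "u \<bullet> J u = 0" for u
    using matrix_inner_transpose[of K "fst u" "snd u"]
    by (simp add: J_def inner_prod_def inner_commute)
  have opt: "G (xs, ys) + J (xs, ys) = 0"
    by (simp add: G_def J_def stat zero_prod_def)
  have cz: "continuous_on {t0..} z" "continuous_on {t0..} dz"
    unfolding z_def dz_def by (intro continuous_intros cx cy)+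
  have dz: "(z has_vector_derivative dz t) (at t)" if "t > t0" for t
    unfolding z_def dz_def by (intro has_vector_derivative_Pair traj that)
  have ddz: "(dz has_vector_derivative - \<alpha> t *\<^sub>R dz t
       - \<beta> t *\<^sub>R (G (z t) + J (z t + (\<theta> * t) *\<^sub>R dz t) + \<epsilon> t *\<^sub>R z t)) (at t)" if "t > t0" for t
    using has_vector_derivative_Pair[OF traj(3)[OF that] traj(4)[OF that]]
    by (simp add: z_def dz_def[abs_def] G_def J_def)
  define gap where "gap t = lagrangian f g K (x t) ys - lagrangian f g K xs (y t)" for t
  have gap: "bregman \<Phi> G (xs, ys) (z t) = gap t" for t
    using matrix_inner_transpose[of K "x t" ys] matrix_inner_transpose[of K xs ys]
    by (simp add: bregman_def \<Phi>_def G_def z_def gap_def lagrangian_def inner_prod_def stat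
        inner_diff_right inner_commute)
  have h: "\<And>t. t \<ge> t0 \<Longrightarrow> 1 + \<theta> - \<theta> * t * \<alpha> t \<le> 0"
    "\<And>t. t \<ge> t0 \<Longrightarrow> (2 * \<theta> - 1) * \<beta> t + \<theta> * t * d\<beta> t \<le> 0"
    "\<And>t. t \<ge> t0 \<Longrightarrow> \<alpha> t + t * d\<alpha> t \<le> t * \<beta> t * \<epsilon> t"
    "\<And>t. t \<ge> t0 \<Longrightarrow> \<alpha> t > 0 \<and> \<beta> t > 0 \<and> \<epsilon> t > 0"
    using assms(7,13,14,15) by auto
  have tangent: "\<Phi> u + G u \<bullet> (v - u) \<le> \<Phi> v" for u v
    by (rule order_trans[OF _ breg[of u v]]) (use c in simp)
  note est = gtrd_lyapunov_estimates[OF t0 \<theta> G tangent linJ skew opt h(4) assms(8,9,10,11)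
      h(1,2,3) assms(17) cz dz ddz, unfolded gap]

  obtain M where M: "\<And>t. t \<ge> t0 \<Longrightarrow> norm (z t) \<le> M" "\<And>t. t \<ge> t0 \<Longrightarrow> t * norm (dz t) \<le> M"
    "\<And>t. t \<ge> t0 \<Longrightarrow> t\<^sup>2 * \<beta> t * gap t \<le> M"
    using est(1) by blast
  have gapG: "c * ((norm (gradient f (x t) - gradient f xs))\<^sup>2
      + (norm (gradient g (y t) - gradient g ys))\<^sup>2) \<le> gap t" for t
    using breg[of "(xs, ys)" "z t"] gap[of t]
    by (simp add: norm_G bregman_def z_def norm_minus_commute)
  have gap0: "gap t \<ge> 0" for t
    by (rule order_trans[OF _ gapG]) (use c in simp)
  have gradf: "(norm (gradient f (x t) - gradient f xs))\<^sup>2 \<le> gap t / c"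
    and gradg: "(norm (gradient g (y t) - gradient g ys))\<^sup>2 \<le> gap t / c" for t
  proof -
    have "0 \<le> c * (norm (gradient f (x t) - gradient f xs))\<^sup>2"
      "0 \<le> c * (norm (gradient g (y t) - gradient g ys))\<^sup>2"
      using c by simp_all
    then have "c * (norm (gradient f (x t) - gradient f xs))\<^sup>2 \<le> gap t"
      "c * (norm (gradient g (y t) - gradient g ys))\<^sup>2 \<le> gap t"
      using gapG[of t] unfolding distrib_left by linarith+
    then show "(norm (gradient f (x t) - gradient f xs))\<^sup>2 \<le> gap t / c"
      "(norm (gradient g (y t) - gradient g ys))\<^sup>2 \<le> gap t / c"
      using c by (simp_all add: pos_le_divide_eq mult.commute)
  qed

  have bigo: "h \<in> O[at_top](k)" if "\<And>t. t \<ge> t0 \<Longrightarrow> \<bar>h t\<bar> \<le> C * \<bar>k t\<bar>" for h k :: "real \<Rightarrow> real" and C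
    using that by (intro bigoI[of _ C]) (auto intro!: eventually_mono[OF eventually_ge_at_top[of t0]])
  have velocity: "r \<le> M * \<bar>1 / t\<bar>" if "r \<le> norm (dz t)" "t \<ge> t0" for r t
  proof -
    have "t * r \<le> M"
      using M(2)[OF that(2)] mult_left_mono[OF that(1), of t] pos(4)[OF that(2)] by linarith
    then show ?thesis using pos(4)[OF that(2)] by (simp add: field_simps)
  qed
  have grad_rate: "r \<le> sqrt (M / c) * \<bar>1 / (t * sqrt (\<beta> t))\<bar>" if "r\<^sup>2 \<le> gap t / c" "t \<ge> t0" for r t
  proof -
    have "(t * sqrt (\<beta> t) * r)\<^sup>2 = t\<^sup>2 * \<beta> t * r\<^sup>2"
      using pos[OF that(2)] by (simp add: power_mult_distrib)
    also have "\<dots> \<le> t\<^sup>2 * \<beta> t * (gap t / c)"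
      using that pos[OF that(2)] by (intro mult_left_mono) auto
    also have "\<dots> \<le> M / c"
      using M(3)[OF that(2)] c by (simp add: divide_right_mono)
    finally have "t * sqrt (\<beta> t) * r \<le> sqrt (M / c)" by (rule real_le_rsqrt)
    then show ?thesis using pos[OF that(2)] by (simp add: field_simps)
  qed
  have grad_int: "(\<lambda>t. ((1 - 2 * \<theta>) * \<beta> t - \<theta> * t * d\<beta> t) * t * (r t)\<^sup>2) absolutely_integrable_on {t0..}"
    if "continuous_on {t0..} r" and r: "\<And>t. (r t)\<^sup>2 \<le> gap t / c" for r
  proof (rule absolutely_integrable_atLeast_le[OF set_integrable_mult_right[OF est(3), of "1 / c"]])
    show "continuous_on {t0..} (\<lambda>t. ((1 - 2 * \<theta>) * \<beta> t - \<theta> * t * d\<beta> t) * t * (r t)\<^sup>2)"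
      by (intro continuous_intros that c\<beta> cd\<beta>)
    fix t assume t: "t \<ge> t0"
    have nn: "((1 - 2 * \<theta>) * \<beta> t - \<theta> * t * d\<beta> t) * t \<ge> 0"
      using h(2)[OF t] pos[OF t] by (intro mult_nonneg_nonneg) (simp_all add: algebra_simps)
    show "0 \<le> ((1 - 2 * \<theta>) * \<beta> t - \<theta> * t * d\<beta> t) * t * (r t)\<^sup>2"
      by (rule mult_nonneg_nonneg[OF nn]) simp
    show "((1 - 2 * \<theta>) * \<beta> t - \<theta> * t * d\<beta> t) * t * (r t)\<^sup>2
        \<le> 1 / c * (((1 - 2 * \<theta>) * \<beta> t - \<theta> * t * d\<beta> t) * t * gap t)"
      using mult_left_mono[OF r nn, of t] by simp
  qed

  show ?thesis
  proof (intro conjI impI)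
    show "bounded ((\<lambda>t. (x t, y t)) ` {t0..})"
      using M(1) by (auto simp: bounded_iff z_def)
    show "(\<lambda>t. lagrangian f g K (x t) ys - lagrangian f g K xs (y t)) \<in> O[at_top](\<lambda>t. 1 / (t\<^sup>2 * \<beta> t))"
      unfolding gap_def[symmetric]
    proof (rule bigo)
      show "\<bar>gap t\<bar> \<le> M * \<bar>1 / (t\<^sup>2 * \<beta> t)\<bar>" if "t \<ge> t0" for t
        using M(3)[OF that] pos[OF that] gap0[of t] by (simp add: field_simps)
    qed
    show "(\<lambda>t. norm (dx t)) \<in> O[at_top](\<lambda>t. 1 / t)" "(\<lambda>t. norm (dy t)) \<in> O[at_top](\<lambda>t. 1 / t)"
      by (rule bigo, simp only: abs_norm_cancel, rule velocity,
          simp_all only: dz_def norm_fst_le norm_snd_le)+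
    show "(\<lambda>t. norm (gradient f (x t) - gradient f xs)) \<in> O[at_top](\<lambda>t. 1 / (t * sqrt (\<beta> t)))"
      by (rule bigo, simp only: abs_norm_cancel) (rule grad_rate[OF gradf])
    show "(\<lambda>t. norm (gradient g (y t) - gradient g ys)) \<in> O[at_top](\<lambda>t. 1 / (t * sqrt (\<beta> t)))"
      by (rule bigo, simp only: abs_norm_cancel) (rule grad_rate[OF gradg])
    show "(\<lambda>t. t * (t * \<alpha> t - 1 / \<theta> - 1) * ((norm (dx t))\<^sup>2 + (norm (dy t))\<^sup>2))
          absolutely_integrable_on {t0..}"
      using est(2) by (simp add: dz_def norm_Pair)
    show "(\<lambda>t. ((1 - 2 * \<theta>) * \<beta> t - \<theta> * t * d\<beta> t) * t
               * (lagrangian f g K (x t) ys - lagrangian f g K xs (y t)))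
          absolutely_integrable_on {t0..}"
      using est(3) by (simp add: gap_def)
    show "(\<lambda>t. ((1 - 2 * \<theta>) * \<beta> t - \<theta> * t * d\<beta> t) * t
               * (norm (gradient f (x t) - gradient f xs))\<^sup>2) absolutely_integrable_on {t0..}"
      by (intro grad_int gradf continuous_intros continuous_on_compose2[OF cf cx(1)]) auto
    show "(\<lambda>t. ((1 - 2 * \<theta>) * \<beta> t - \<theta> * t * d\<beta> t) * t
               * (norm (gradient g (y t) - gradient g ys))\<^sup>2) absolutely_integrable_on {t0..}"
      by (intro grad_int gradg continuous_intros continuous_on_compose2[OF cg cy(1)]) auto
  qed
qed

end
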